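(* Let $\boldsymbol\kappa$ be a multicharge (in type ${\tt A}_1^{(1)}$), and let $\boldsymbol\lambda$ be a $\boldsymbol\kappa$-multipartition of level $\ell$. Then $\boldsymbol\lambda$ is Kleshchev if and only if it satisfies all of the following conditions: (1) The partition $\lambda^{(t)}$ is 2-restricted for all $t \in [1,\ell]$. (2) For all $t \in [1,\ell-1]$, we have $\lambda^{(t)}_1 - (\lambda^{(t+1)})'_1 \geq \delta_{\kappa_t, \kappa_{t+1}} - 1$. (3) If $s \in [1,\ell-2]$ and $u \in [s+2,\ell]$ are such that $\lambda^{(u)} \neq \varnothing$ and $\kappa_s \neq \kappa_{s+1} = \cdots = \kappa_{u-1} \neq \kappa_u$, then there exists $t \in [s,u-1]$ such that $\lambda^{(t)}_1 - (\lambda^{(t+1)})'_1 \geq \delta_{\kappa_t, \kappa_{t+1}}+1$.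
   Context: Partitions are identified with Young diagrams (English convention); $\lambda_1$ is the first row length ($0$ if empty), $\lambda'$ is the conjugate partition, so $\lambda'_1$ is the number of nonzero rows. $\lambda$ is 2-restricted if no two of its nonzero columns have equal length. $\delta_{a,b}$ is the Kronecker delta. A multicharge $\boldsymbol\kappa=(\kappa_1,\kappa_2,\ldots)$ is a sequence of elements of $\mathbb{Z}_2=\mathbb{Z}/2\mathbb{Z}$ containing infinitely many $0$'s and infinitely many $1$'s. A $\boldsymbol\kappa$-multipartition $\boldsymbol\lambda=(\lambda^{(1)},\lambda^{(2)},\ldots)$ is a sequence of partitions with $\lambda^{(t)}=\varnothing$ for $t\gg0$; the box in row $r$ and column $c$ of component $t$ has residue $\kappa_t+c-r\in\mathbb{Z}_2$. It is of level $\ell$ if $\lambda^{(m)}=\varnothing$ for all $m>\ell$. Components are arranged in a vertical array with $\lambda^{(1)}$ at the bottom, $\lambda^{(2)}$ above it, and so on; "top", "bottom", "above", "below" refer to this arrangement. For $i\in\mathbb{Z}_2$, a box $u\in\boldsymbol\lambda$ is $i$-removable if it has residue $i$ and $\boldsymbol\lambda\setminus u$ is a $\boldsymbol\kappa$-multipartition; a box $u\notin\boldsymbol\lambda$ is $i$-addable if it has residue $i$ and $\boldsymbol\lambda\sqcup u$ is a $\boldsymbol\kappa$-multipartition. The $i$-arc arrangement of $\boldsymbol\lambda$: reading top to bottom, whenever an $i$-removable box is followed by an $i$-addable box with no unarced $i$-removable or $i$-addable boxes between them, draw an arc connecting them; repeat until no more such arcs are possible. $f_i\boldsymbol\lambda$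 is obtained by adding the bottommost unarced $i$-addable box; $e_i\boldsymbol\lambda$ is obtained by deleting the topmost unarced $i$-removable box, and $e_i\boldsymbol\lambda=0$ if there is none. $\boldsymbol\lambda$ is Kleshchev if $\boldsymbol\lambda=f_{i_m}\cdots f_{i_2}f_{i_1}\varnothing$ for some $m\ge0$ and $(i_1,\ldots,i_m)\in\mathbb{Z}_2^m$ (equivalently $\varnothing=e_{i_1}e_{i_2}\cdots e_{i_m}\boldsymbol\lambda$), where $\varnothing$ is the empty multipartition. *)

theory Defs
  imports "HOL-Library.Z2"
begin

text \<open>
  Partitions are Young diagrams, that is, sets of boxes \<open>(r, c)\<close> with row \<open>r \<ge> 1\<close> and column
  \<open>c \<ge> 1\<close> in the English convention (row 1 is the top row). The lemma
  \<open>young_diagram_iff_rows\<close> recovers the description by weakly decreasing row lengths.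
\<close>

type_synonym diagram = "(nat \<times> nat) set"

definition young_diagram :: "diagram \<Rightarrow> bool" where
  "young_diagram D \<longleftrightarrow> finite D \<and> D \<subseteq> {1..} \<times> {1..} \<and>
     (\<forall>(r, c) \<in> D. \<forall>r' \<in> {1..r}. \<forall>c' \<in> {1..c}. (r', c') \<in> D)"

definition row_len :: "diagram \<Rightarrow> nat \<Rightarrow> nat" where
  "row_len D r = card {c. (r, c) \<in> D}"

definition conjugate :: "diagram \<Rightarrow> diagram" where
  "conjugate D = {(c, r). (r, c) \<in> D}"

definition col_len :: "diagram \<Rightarrow> nat \<Rightarrow> nat" where
  "col_len D c = card {r. (r, c) \<in> D}"

definition two_restricted :: "diagram \<Rightarrow> bool" where
  "two_restricted D \<longleftrightarrow> inj_on (col_len D) {c. col_len D c \<noteq> 0}"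

text \<open>
  Sequences indexed by \<open>1, 2, \<dots>\<close> are functions on \<^typ>\<open>nat\<close>. The value of a multicharge at \<open>0\<close> is
  irrelevant, and a multipartition is required to be empty at \<open>0\<close>, so that equality of
  functions is equality of multipartitions. The type \<^typ>\<open>bit\<close> is the field of integers modulo 2.
\<close>

type_synonym multicharge = "nat \<Rightarrow> bit"
type_synonym multidiagram = "nat \<Rightarrow> diagram"

definition multicharge :: "multicharge \<Rightarrow> bool" where
  "multicharge \<kappa> \<longleftrightarrow> infinite {t. 1 \<le> t \<and> \<kappa> t = 0} \<and> infinite {t. 1 \<le> t \<and> \<kappa> t = 1}"

text \<open>The multicharge does not restrict which sequences are multipartitions, only their residues.\<close>

definition multipartition :: "multidiagram \<Rightarrow> bool" where
  "multipartition lam \<longleftrightarrow>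
     (\<forall>t. young_diagram (lam t)) \<and> lam 0 = {} \<and> (\<exists>N. \<forall>t > N. lam t = {})"

definition has_level :: "multidiagram \<Rightarrow> nat \<Rightarrow> bool" where
  "has_level lam l \<longleftrightarrow> (\<forall>m > l. lam m = {})"

definition empty_multipartition :: multidiagram where
  "empty_multipartition = (\<lambda>_. {})"

text \<open>A box \<open>(t, r, c)\<close> lies in row \<open>r\<close> and column \<open>c\<close> of component \<open>t\<close>.\<close>

type_synonym box = "nat \<times> nat \<times> nat"

definition boxes :: "multidiagram \<Rightarrow> box set" where
  "boxes lam = {(t, r, c). (r, c) \<in> lam t}"

definition residue :: "multicharge \<Rightarrow> box \<Rightarrow> bit" where
  "residue \<kappa> = (\<lambda>(t, r, c). \<kappa> t + of_nat c - of_nat r)"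

definition add_box :: "box \<Rightarrow> multidiagram \<Rightarrow> multidiagram" where
  "add_box = (\<lambda>(t, r, c) lam. lam(t := insert (r, c) (lam t)))"

definition remove_box :: "box \<Rightarrow> multidiagram \<Rightarrow> multidiagram" where
  "remove_box = (\<lambda>(t, r, c) lam. lam(t := lam t - {(r, c)}))"

definition removable :: "multicharge \<Rightarrow> bit \<Rightarrow> multidiagram \<Rightarrow> box \<Rightarrow> bool" where
  "removable \<kappa> i lam u \<longleftrightarrow>
     u \<in> boxes lam \<and> residue \<kappa> u = i \<and> multipartition (remove_box u lam)"

definition addable :: "multicharge \<Rightarrow> bit \<Rightarrow> multidiagram \<Rightarrow> box \<Rightarrow> bool" where
  "addable \<kappa> i lam u \<longleftrightarrow>
     u \<notin> boxes lam \<and> residue \<kappa> u = i \<and> multipartition (add_box u lam)"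

text \<open>
  Component \<open>t + 1\<close> is drawn above component \<open>t\<close>, while inside a component smaller row numbers are
  higher. Columns need no comparison: a removable and an addable box in the same row are adjacent,
  hence have different residues, so no row contains two \<open>i\<close>-removable or \<open>i\<close>-addable boxes.
\<close>

definition above :: "box \<Rightarrow> box \<Rightarrow> bool" where
  "above = (\<lambda>(t, r, c) (t', r', c'). t' < t \<or> t' = t \<and> r < r')"

text \<open>
  A set of arcs is a relation from \<open>i\<close>-removable to \<open>i\<close>-addable boxes, and its \<^const>\<open>Field\<close> is the
  set of arced boxes.
\<close>

definition can_draw_arc ::
    "multicharge \<Rightarrow> bit \<Rightarrow> multidiagram \<Rightarrow> (box \<times> box) set \<Rightarrow> box \<Rightarrow> box \<Rightarrow> bool" where
  "can_draw_arc \<kappa> i lam A u v \<longleftrightarrow>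
     removable \<kappa> i lam u \<and> addable \<kappa> i lam v \<and> above u v \<and> u \<notin> Field A \<and> v \<notin> Field A \<and>
     (\<forall>w. (removable \<kappa> i lam w \<or> addable \<kappa> i lam w) \<and> above u w \<and> above w v \<longrightarrow> w \<in> Field A)"

inductive partial_arcs :: "multicharge \<Rightarrow> bit \<Rightarrow> multidiagram \<Rightarrow> (box \<times> box) set \<Rightarrow> bool"
  for \<kappa> :: multicharge and i :: bit and lam :: multidiagram where
  no_arcs: "partial_arcs \<kappa> i lam {}"
| draw_arc: "partial_arcs \<kappa> i lam A \<Longrightarrow> can_draw_arc \<kappa> i lam A u v \<Longrightarrow>
    partial_arcs \<kappa> i lam (insert (u, v) A)"

text \<open>The result of drawing arcs until no more are possible does not depend on the order chosen.\<close>

definition arc_arrangement :: "multicharge \<Rightarrow> bit \<Rightarrow> multidiagram \<Rightarrow> (box \<times> box) set" where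
  "arc_arrangement \<kappa> i lam =
     (THE A. partial_arcs \<kappa> i lam A \<and> (\<nexists>u v. can_draw_arc \<kappa> i lam A u v))"

definition unarced_addable :: "multicharge \<Rightarrow> bit \<Rightarrow> multidiagram \<Rightarrow> box set" where
  "unarced_addable \<kappa> i lam =
     {u. addable \<kappa> i lam u \<and> u \<notin> Field (arc_arrangement \<kappa> i lam)}"

text \<open>
  For a multicharge in the above sense there are infinitely many \<open>i\<close>-addable boxes and only finitely
  many \<open>i\<close>-removable ones, so the bottommost unarced \<open>i\<close>-addable box exists.
\<close>

definition f_op :: "multicharge \<Rightarrow> bit \<Rightarrow> multidiagram \<Rightarrow> multidiagram" where
  "f_op \<kappa> i lam = add_box
     (THE u. u \<in> unarced_addable \<kappa> i lam \<and> (\<forall>v \<in> unarced_addable \<kappa> i lam. v \<noteq> u \<longrightarrow> above v u))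
     lam"

definition kleshchev :: "multicharge \<Rightarrow> multidiagram \<Rightarrow> bool" where
  "kleshchev \<kappa> lam \<longleftrightarrow> (\<exists>is. lam = fold (f_op \<kappa>) is empty_multipartition)"

lemma young_diagram_iff_rows:
  "young_diagram D \<longleftrightarrow>
     (\<exists>\<mu> :: nat \<Rightarrow> nat. (\<forall>r \<ge> 1. \<mu> (Suc r) \<le> \<mu> r) \<and> (\<exists>N. \<forall>r > N. \<mu> r = 0) \<and>
        D = {(r, c). 1 \<le> r \<and> 1 \<le> c \<and> c \<le> \<mu> r})" (is "_ \<longleftrightarrow> ?R")
proof
  assume D: "young_diagram D"
  have fin: "finite D" and pos: "\<And>r c. (r, c) \<in> D \<Longrightarrow> 1 \<le> r \<and> 1 \<le> c"
    and down: "\<And>r c r' c'. (r, c) \<in> D \<Longrightarrow> 1 \<le> r' \<Longrightarrow> r' \<le> r \<Longrightarrow> 1 \<le> c' \<Longrightarrow> c' \<le> c \<Longrightarrow> (r', c') \<in> D"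
  proof -
    show "finite D" using D by (simp add: young_diagram_def)
    show "1 \<le> r \<and> 1 \<le> c" if "(r, c) \<in> D" for r c
      using D that unfolding young_diagram_def by fastforce
    have "\<forall>x \<in> D. case x of (r, c) \<Rightarrow> \<forall>r' \<in> {1..r}. \<forall>c' \<in> {1..c}. (r', c') \<in> D"
      using D unfolding young_diagram_def by (elim conjE)
    then show "(r', c') \<in> D"
      if "(r, c) \<in> D" "1 \<le> r'" "r' \<le> r" "1 \<le> c'" "c' \<le> c" for r c r' c'
      using that by (metis (no_types, lifting) atLeastAtMost_iff case_prodD)
  qed
  define \<mu> where "\<mu> r = Max (insert 0 {c. (r, c) \<in> D})" for r
  have finr: "finite {c. (r, c) \<in> D}" for r
  proof (rule finite_subset)
    show "{c. (r, c) \<in> D} \<subseteq> snd ` D" by force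
    show "finite (snd ` D)" using fin by simp
  qed
  have mem: "(r, c) \<in> D \<longleftrightarrow> 1 \<le> r \<and> 1 \<le> c \<and> c \<le> \<mu> r" for r c
  proof
    show "1 \<le> r \<and> 1 \<le> c \<and> c \<le> \<mu> r" if "(r, c) \<in> D"
      using that pos[OF that] finr[of r] by (auto simp: \<mu>_def intro!: Max_ge)
    assume a: "1 \<le> r \<and> 1 \<le> c \<and> c \<le> \<mu> r"
    have "\<mu> r \<in> insert 0 {c. (r, c) \<in> D}" unfolding \<mu>_def by (rule Max_in) (use finr in auto)
    then have "(r, \<mu> r) \<in> D" using a by auto
    then show "(r, c) \<in> D" using down[of r "\<mu> r" r c] a by simp
  qed
  have "\<mu> (Suc r) \<le> \<mu> r" if "r \<ge> 1" for r
  proof (cases "\<mu> (Suc r) = 0")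
    case False
    then have "(Suc r, \<mu> (Suc r)) \<in> D" by (simp add: mem)
    then have "(r, \<mu> (Suc r)) \<in> D" using down[of "Suc r" "\<mu> (Suc r)" r "\<mu> (Suc r)"] that False by simp
    then show ?thesis using mem by blast
  qed simp
  moreover have "\<mu> r = 0" if "r > Max (insert 0 (fst ` D))" for r
  proof (rule ccontr)
    assume "\<mu> r \<noteq> 0"
    then have "(r, 1) \<in> D" using that by (simp add: mem)
    then have "r \<in> fst ` D" by (metis fst_conv image_eqI)
    then have "r \<le> Max (insert 0 (fst ` D))" using fin by (intro Max_ge) auto
    then show False using that by simp
  qed
  moreover have "D = {(r, c). 1 \<le> r \<and> 1 \<le> c \<and> c \<le> \<mu> r}" using mem by auto
  ultimately show ?R by blast
next
  assume ?R
  then obtain \<mu> :: "nat \<Rightarrow> nat" and N where dec: "\<And>r. r \<ge> 1 \<Longrightarrow> \<mu> (Suc r) \<le> \<mu> r"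
    and N: "\<And>r. r > N \<Longrightarrow> \<mu> r = 0" and D: "D = {(r, c). 1 \<le> r \<and> 1 \<le> c \<and> c \<le> \<mu> r}" by blast
  have mono: "\<mu> r \<le> \<mu> r'" if "1 \<le> r'" "r' \<le> r" for r r'
    using that(2)
  proof (induction r rule: dec_induct)
    case (step n)
    then show ?case using dec[of n] that(1) by linarith
  qed simp
  have "D \<subseteq> {1..N} \<times> {1..\<mu> 1}"
  proof
    fix x assume "x \<in> D"
    then obtain r c where x: "x = (r, c)" "1 \<le> r" "1 \<le> c" "c \<le> \<mu> r" using D by auto
    then have "r \<le> N" using N[of r] by (cases "r \<le> N") auto
    moreover have "c \<le> \<mu> 1" using mono[of 1 r] x by simp
    ultimately show "x \<in> {1..N} \<times> {1..\<mu> 1}" using x by simp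
  qed
  then have "finite D" by (rule finite_subset) simp
  moreover have "(r', c') \<in> D" if "(r, c) \<in> D" "1 \<le> r'" "r' \<le> r" "1 \<le> c'" "c' \<le> c" for r c r' c'
    using that mono[of r' r] by (auto simp: D)
  ultimately show "young_diagram D"
    unfolding young_diagram_def by (auto simp: D)
qed

end

theory Submission
  imports Defs
begin

text \<open>
  The moves that build Kleshchev multipartitions are reversible: \<^const>\<open>f_op\<close> undoes the deletion of the
  topmost unarced removable box (\<open>f_op_remove_good\<close>). It therefore suffices to show that the set
  cut out by the three conditions contains the empty multipartition, is closed under adding
  (\<open>admissible_add_good\<close>) and deleting (\<open>admissible_remove_good\<close>) good boxes, and that each of its
  nonempty members has a good box to delete (\<open>ex_good_removable_admissible\<close>).

  Closure rests on one observation about arcs. If two addable boxes of residue \<open>i\<close> follow each other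
  without an \<open>i\<close>-removable box in between, the upper one is never the bottommost unarced one; dually
  the lower of two such removable boxes is never the topmost unarced one. Whenever a box would destroy
  one of the conditions, it has such a neighbour. Inside a component the neighbour is one step
  down and to the left, or up and to the right, which takes care of 2-restrictedness.

  The second and third conditions bound the number
  \<open>\<lambda>\<^sup>(\<^sup>t\<^sup>)\<^sub>1 - (\<lambda>\<^sup>(\<^sup>t\<^sup>+\<^sup>1\<^sup>))'\<^sub>1 - \<delta>\<close>,
  called the gap at \<open>t\<close>, from below: by \<open>-1\<close> everywhere, and by \<open>1\<close> somewhere in certain ranges.
  The gap is odd exactly when the boxes addable to the first row of component \<open>t\<close> and to the first
  column of component \<open>t + 1\<close> have the same
  residue. As a move changes a gap by at most one, a bound can only be lost starting from the odd
  value \<open>-1\<close> or \<open>1\<close>, and then the neighbour lies across the boundary. The exceptions are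
  caused by empty components, where the neighbour is found by following the run of
  empty components (\<open>good_addable_into_empty\<close>, \<open>good_removable_over_empty\<close>).
\<close>

section \<open>Young diagrams as sets of boxes\<close>

lemma young_diagram_boxD: "young_diagram D \<Longrightarrow> (r, c) \<in> D \<Longrightarrow> 1 \<le> r \<and> 1 \<le> c"
  unfolding young_diagram_def by fastforce

lemma young_diagram_downD:
  assumes "young_diagram D" "(r, c) \<in> D" "1 \<le> r'" "r' \<le> r" "1 \<le> c'" "c' \<le> c"
  shows "(r', c') \<in> D"
proof -
  have "\<forall>x \<in> D. case x of (r, c) \<Rightarrow> \<forall>r' \<in> {1..r}. \<forall>c' \<in> {1..c}. (r', c') \<in> D"
    using assms(1) unfolding young_diagram_def by (elim conjE)
  from bspec[OF this assms(2)] show ?thesis using assms(3-6) by simp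
qed

lemma young_diagramI:
  assumes "finite D" "\<And>r c. (r, c) \<in> D \<Longrightarrow> 1 \<le> r \<and> 1 \<le> c"
    "\<And>r c r' c'. (r, c) \<in> D \<Longrightarrow> 1 \<le> r' \<Longrightarrow> r' \<le> r \<Longrightarrow> 1 \<le> c' \<Longrightarrow> c' \<le> c \<Longrightarrow> (r', c') \<in> D"
  shows "young_diagram D"
  unfolding young_diagram_def
proof (intro conjI ballI)
  show "D \<subseteq> {1..} \<times> {1..}" using assms(2) by auto
  show "case x of (r, c) \<Rightarrow> \<forall>r' \<in> {1..r}. \<forall>c' \<in> {1..c}. (r', c') \<in> D" if "x \<in> D" for x
    using assms(3)[of "fst x" "snd x"] that by (cases x) simp
qed (rule assms(1))

lemma young_diagram_empty [simp]: "young_diagram {}"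
  by (simp add: young_diagram_def)

lemma young_diagram_conjugate:
  assumes "young_diagram D" shows "young_diagram (conjugate D)"
proof (rule young_diagramI)
  have "conjugate D = prod.swap ` D" by (force simp: conjugate_def)
  then show "finite (conjugate D)" using assms by (simp add: young_diagram_def)
  show "1 \<le> c \<and> 1 \<le> r" if "(c, r) \<in> conjugate D" for r c
    using that young_diagram_boxD[OF assms, of r c] by (simp add: conjugate_def)
  show "(c', r') \<in> conjugate D"
    if "(c, r) \<in> conjugate D" "1 \<le> c'" "c' \<le> c" "1 \<le> r'" "r' \<le> r" for r c r' c'
    using that young_diagram_downD[OF assms, of r c r' c'] by (simp add: conjugate_def)
qed

lemma mem_iff_row_len:
  assumes "young_diagram D"
  shows "(r, c) \<in> D \<longleftrightarrow> 1 \<le> r \<and> 1 \<le> c \<and> c \<le> row_len D r"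
proof -
  obtain \<mu> :: "nat \<Rightarrow> nat" where D: "D = {(r, c). 1 \<le> r \<and> 1 \<le> c \<and> c \<le> \<mu> r}"
    using assms unfolding young_diagram_iff_rows by blast
  have "{c. (r, c) \<in> D} = {1..\<mu> r}" if "1 \<le> r"
    using that by (auto simp: D)
  then have "row_len D r = \<mu> r" if "1 \<le> r"
    using that by (simp add: row_len_def)
  then show ?thesis by (auto simp: D)
qed

lemma mem_iff_col_len:
  assumes "young_diagram D"
  shows "(r, c) \<in> D \<longleftrightarrow> 1 \<le> r \<and> 1 \<le> c \<and> r \<le> col_len D c"
proof -
  have "row_len (conjugate D) c = col_len D c"
    by (simp add: row_len_def col_len_def conjugate_def)
  then show ?thesis
    using mem_iff_row_len[OF young_diagram_conjugate[OF assms], of c r]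
    by (auto simp: conjugate_def)
qed

text \<open>
  Strictly decreasing column lengths amount to closure under the step one down and one to the
  left. That step preserves residues, which is why 2-restrictedness interacts well with adding
  and removing boxes of a fixed residue.
\<close>

lemma two_restricted_iff:
  assumes "young_diagram D"
  shows "two_restricted D \<longleftrightarrow> (\<forall>r c. 1 \<le> c \<longrightarrow> (r, Suc c) \<in> D \<longrightarrow> (Suc r, c) \<in> D)"
proof (intro iffI allI impI)
  fix r c assume R: "two_restricted D" and c: "(1::nat) \<le> c" and rc: "(r, Suc c) \<in> D"
  let ?n = "col_len D (Suc c)"
  have r: "1 \<le> r" "r \<le> ?n" using rc mem_iff_col_len[OF assms] by auto
  then have "(?n, Suc c) \<in> D" using mem_iff_col_len[OF assms] by auto
  then have "(?n, c) \<in> D" using young_diagram_downD[OF assms, of ?n "Suc c" ?n c] c r by auto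
  then have "?n \<le> col_len D c" using mem_iff_col_len[OF assms] by auto
  moreover have "?n \<noteq> col_len D c"
    using R r calculation unfolding two_restricted_def inj_on_def
    by (metis (mono_tags, lifting) mem_Collect_eq le_zero_eq n_not_Suc_n not_one_le_zero)
  ultimately show "(Suc r, c) \<in> D" using r c mem_iff_col_len[OF assms] by auto
next
  assume R: "\<forall>r c. 1 \<le> c \<longrightarrow> (r, Suc c) \<in> D \<longrightarrow> (Suc r, c) \<in> D"
  have less: "col_len D c' < col_len D c" if "c < c'" "col_len D c \<noteq> 0" "col_len D c' \<noteq> 0" for c c'
  proof -
    have "c \<noteq> 0"
    proof
      assume "c = 0"
      then have "{r. (r, c) \<in> D} = {}" using young_diagram_boxD[OF assms] by force
      then show False using that by (simp add: col_len_def)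
    qed
    then have "(col_len D c', Suc (c' - 1)) \<in> D" using that mem_iff_col_len[OF assms] by auto
    then have "(Suc (col_len D c'), c' - 1) \<in> D" using R that \<open>c \<noteq> 0\<close> by auto
    then have "(Suc (col_len D c'), c) \<in> D"
      using young_diagram_downD[OF assms] that \<open>c \<noteq> 0\<close> by auto
    then show ?thesis using mem_iff_col_len[OF assms] by auto
  qed
  then show "two_restricted D" unfolding two_restricted_def inj_on_def
    by (metis (mono_tags, lifting) linorder_neqE_nat mem_Collect_eq nat_neq_iff)
qed

definition width :: "diagram \<Rightarrow> nat" where
  "width D = row_len D 1"

definition height :: "diagram \<Rightarrow> nat" where
  "height D = row_len (conjugate D) 1"

lemma mem_row_1: "young_diagram D \<Longrightarrow> (Suc 0, c) \<in> D \<longleftrightarrow> 1 \<le> c \<and> c \<le> width D"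
  using mem_iff_row_len[of D 1 c] by (simp add: width_def)

lemma mem_col_1: "young_diagram D \<Longrightarrow> (r, Suc 0) \<in> D \<longleftrightarrow> 1 \<le> r \<and> r \<le> height D"
  using mem_iff_row_len[OF young_diagram_conjugate, of D 1 r]
  by (simp add: height_def conjugate_def)

lemma width_eq_0_iff: "young_diagram D \<Longrightarrow> width D = 0 \<longleftrightarrow> D = {}"
  using mem_row_1[of D] young_diagram_boxD[of D] young_diagram_downD[of D]
  by (metis One_nat_def all_not_in_conv le_refl le_zero_eq less_one linorder_not_less old.prod.exhaust)

lemma height_eq_0_iff: "young_diagram D \<Longrightarrow> height D = 0 \<longleftrightarrow> D = {}"
  using mem_col_1[of D] young_diagram_boxD[of D] young_diagram_downD[of D]
  by (metis One_nat_def all_not_in_conv le_refl le_zero_eq less_one linorder_not_less old.prod.exhaust)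

lemma width_empty [simp]: "width {} = 0" and height_empty [simp]: "height {} = 0"
  using width_eq_0_iff[of "{}"] height_eq_0_iff[of "{}"] by auto

lemma young_diagram_insert_iff:
  assumes "young_diagram D" "(r, c) \<notin> D"
  shows "young_diagram (insert (r, c) D) \<longleftrightarrow>
    1 \<le> r \<and> 1 \<le> c \<and> (r = 1 \<or> (r - 1, c) \<in> D) \<and> (c = 1 \<or> (r, c - 1) \<in> D)" (is "?L = ?R")
proof
  assume L: ?L
  then have pos: "1 \<le> r" "1 \<le> c" using young_diagram_boxD[OF L, of r c] by auto
  have "(r - 1, c) \<in> D" if "r \<noteq> 1"
  proof -
    have "1 \<le> r - 1" "r - 1 \<noteq> r" using pos that by linarith+
    then show ?thesis using young_diagram_downD[OF L, of r c "r - 1" c] pos by simp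
  qed
  moreover have "(r, c - 1) \<in> D" if "c \<noteq> 1"
  proof -
    have "1 \<le> c - 1" "c - 1 \<noteq> c" using pos that by linarith+
    then show ?thesis using young_diagram_downD[OF L, of r c r "c - 1"] pos by simp
  qed
  ultimately show ?R using pos by auto
next
  assume R: ?R
  show ?L
  proof (rule young_diagramI)
    show "finite (insert (r, c) D)" using assms by (simp add: young_diagram_def)
    show "1 \<le> a \<and> 1 \<le> b" if "(a, b) \<in> insert (r, c) D" for a b
      using that R young_diagram_boxD[OF assms(1)] by auto
    show "(a', b') \<in> insert (r, c) D"
      if ab: "(a, b) \<in> insert (r, c) D" "1 \<le> a'" "a' \<le> a" "1 \<le> b'" "b' \<le> b" for a b a' b'
    proof (cases "(a, b) \<in> D")
      case True
      then show ?thesis using young_diagram_downD[OF assms(1)] ab by blast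
    next
      case False
      then have "a = r" "b = c" using ab by auto
      then consider "a' = r \<and> b' = c" | "a' \<le> r - 1" | "b' \<le> c - 1" using ab by linarith
      then show ?thesis
      proof cases
        case 2
        then have "(r - 1, c) \<in> D" using R ab by auto
        then show ?thesis using young_diagram_downD[OF assms(1), of "r-1" c a' b'] 2 ab \<open>b = c\<close> by auto
      next
        case 3
        then have "(r, c - 1) \<in> D" using R ab by auto
        then show ?thesis using young_diagram_downD[OF assms(1), of r "c-1" a' b'] 3 ab \<open>a = r\<close> by auto
      qed auto
    qed
  qed
qed

lemma young_diagram_remove_iff:
  assumes "young_diagram D" "(r, c) \<in> D"
  shows "young_diagram (D - {(r, c)}) \<longleftrightarrow> (Suc r, c) \<notin> D \<and> (r, Suc c) \<notin> D" (is "?L = ?R")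
proof
  assume L: ?L
  show ?R
    using young_diagram_downD[OF L, of "Suc r" c r c] young_diagram_downD[OF L, of r "Suc c" r c]
      young_diagram_boxD[OF assms] by auto
next
  assume R: ?R
  show ?L
  proof (rule young_diagramI)
    show "finite (D - {(r, c)})" using assms by (simp add: young_diagram_def)
    show "1 \<le> a \<and> 1 \<le> b" if "(a, b) \<in> D - {(r, c)}" for a b
      using that young_diagram_boxD[OF assms(1)] by auto
    show "(a', b') \<in> D - {(r, c)}"
      if ab: "(a, b) \<in> D - {(r, c)}" "1 \<le> a'" "a' \<le> a" "1 \<le> b'" "b' \<le> b" for a b a' b'
    proof -
      have "(a', b') \<noteq> (r, c)"
      proof
        assume eq: "(a', b') = (r, c)"
        then have "r < a \<or> c < b" using ab by auto
        then have "(Suc r, c) \<in> D \<or> (r, Suc c) \<in> D"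
          using young_diagram_downD[OF assms(1), of a b "Suc r" c]
            young_diagram_downD[OF assms(1), of a b r "Suc c"] ab eq by auto
        then show False using R by blast
      qed
      then show ?thesis using young_diagram_downD[OF assms(1), of a b a' b'] ab by auto
    qed
  qed
qed

lemma width_insert:
  assumes "young_diagram D" "(r, c) \<notin> D" "young_diagram (insert (r, c) D)"
  shows "width (insert (r, c) D) = (if r = 1 then Suc (width D) else width D)"
    and "r = 1 \<Longrightarrow> c = Suc (width D)"
proof -
  show c: "c = Suc (width D)" if "r = 1"
    using assms that mem_row_1[OF assms(1), of c] mem_row_1[OF assms(1), of "c - 1"]
    by (auto simp: young_diagram_insert_iff)
  have mem: "c' \<le> width (insert (r, c) D) \<longleftrightarrow> c' \<le> width D \<or> r = 1 \<and> c' = c" if "1 \<le> c'" for c'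
    using mem_row_1[OF assms(1), of c'] mem_row_1[OF assms(3), of c'] that by auto
  show "width (insert (r, c) D) = (if r = 1 then Suc (width D) else width D)"
  proof (rule order.antisym)
    show "width (insert (r, c) D) \<le> (if r = 1 then Suc (width D) else width D)"
      using mem[of "width (insert (r, c) D)"] c by (cases "width (insert (r, c) D)") auto
    show "(if r = 1 then Suc (width D) else width D) \<le> width (insert (r, c) D)"
      using mem[of "Suc (width D)"] mem[of "width D"] c by (cases "width D") auto
  qed
qed

lemma height_insert:
  assumes "young_diagram D" "(r, c) \<notin> D" "young_diagram (insert (r, c) D)"
  shows "height (insert (r, c) D) = (if c = 1 then Suc (height D) else height D)"
    and "c = 1 \<Longrightarrow> r = Suc (height D)"
proof -
  have "conjugate (insert (r, c) D) = insert (c, r) (conjugate D)" by (auto simp: conjugate_def)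
  moreover have "(c, r) \<notin> conjugate D" using assms by (simp add: conjugate_def)
  moreover have "height E = width (conjugate E)" for E by (simp add: height_def width_def)
  ultimately show "height (insert (r, c) D) = (if c = 1 then Suc (height D) else height D)"
    and "c = 1 \<Longrightarrow> r = Suc (height D)"
    using width_insert[of "conjugate D" c r] young_diagram_conjugate[OF assms(1)]
      young_diagram_conjugate[OF assms(3)] by auto
qed

lemma of_nat_bit: "(of_nat n :: bit) = of_bool (odd n)"
  by (induction n) auto

text \<open>
  Comparisons of residues are reduced to parities of row and column numbers by this lemma.
\<close>

lemma residue_eq_iff:
  fixes x y :: bit
  shows "x + of_nat c - of_nat r = y + of_nat c' - of_nat r' \<longleftrightarrow>
    (x = y \<longleftrightarrow> even (c + r + c' + r'))"
  by (cases x; cases y; cases "even c"; cases "even r"; cases "even c'"; cases "even r'";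
      simp add: of_nat_bit)

section \<open>Addable and removable boxes\<close>

lemma multipartition_young: "multipartition lam \<Longrightarrow> young_diagram (lam t)"
  by (simp add: multipartition_def)

lemma multipartition_0: "multipartition lam \<Longrightarrow> lam 0 = {}"
  by (simp add: multipartition_def)

lemma multipartition_upd_iff:
  assumes "multipartition lam"
  shows "multipartition (lam(t := D)) \<longleftrightarrow> young_diagram D \<and> (t = 0 \<longrightarrow> D = {})"
proof -
  obtain N where "\<forall>t > N. lam t = {}" using assms by (auto simp: multipartition_def)
  then have "\<forall>t' > max N t. (lam(t := D)) t' = {}" by auto
  then show ?thesis using assms unfolding multipartition_def
    by (metis fun_upd_apply)
qed

lemma addable_iff:
  assumes "multipartition lam"
  shows "addable \<kappa> i lam (t, r, c) \<longleftrightarrow>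
    1 \<le> t \<and> 1 \<le> r \<and> 1 \<le> c \<and> (r, c) \<notin> lam t \<and> \<kappa> t + of_nat c - of_nat r = i \<and>
    (r = 1 \<or> (r - 1, c) \<in> lam t) \<and> (c = 1 \<or> (r, c - 1) \<in> lam t)"
  using young_diagram_insert_iff[OF multipartition_young[OF assms], of r c t]
  by (auto simp: addable_def boxes_def residue_def add_box_def multipartition_upd_iff[OF assms]
      not_less_eq_eq)

lemma removable_iff:
  assumes "multipartition lam"
  shows "removable \<kappa> i lam (t, r, c) \<longleftrightarrow>
    (r, c) \<in> lam t \<and> \<kappa> t + of_nat c - of_nat r = i \<and> (Suc r, c) \<notin> lam t \<and> (r, Suc c) \<notin> lam t"
proof (cases "(r, c) \<in> lam t")
  case True
  then have "t \<noteq> 0" using multipartition_0[OF assms] by (auto intro!: gr0I)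
  then show ?thesis
    using young_diagram_remove_iff[OF multipartition_young[OF assms] True] True
    by (auto simp: removable_def boxes_def residue_def remove_box_def multipartition_upd_iff[OF assms])
qed (simp add: removable_def boxes_def)

lemma finite_boxes:
  assumes "multipartition lam" shows "finite (boxes lam)"
proof -
  obtain N where "\<forall>t > N. lam t = {}" using assms by (auto simp: multipartition_def)
  then have "boxes lam \<subseteq> (\<Union>t \<in> {..N}. Pair t ` lam t)"
    unfolding boxes_def by (force simp: not_less[symmetric])
  moreover have "finite (\<Union>t \<in> {..N}. Pair t ` lam t)"
    using multipartition_young[OF assms] by (auto simp: young_diagram_def)
  ultimately show ?thesis by (rule finite_subset)
qed

lemma finite_removable:
  assumes "multipartition lam" shows "finite {u. removable \<kappa> i lam u}"
  by (rule finite_subset[OF _ finite_boxes[OF assms]]) (auto simp: removable_def)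

text \<open>
  There may be infinitely many addable boxes, but all except finitely many lie above any given box.
  This is why a bottommost one exists and why only finitely many lie between two boxes.
\<close>

lemma finite_addable_upto:
  assumes "multipartition lam" shows "finite {u. addable \<kappa> i lam u \<and> fst u \<le> T}"
proof -
  have "{u. addable \<kappa> i lam u \<and> fst u \<le> T} \<subseteq>
    (\<Union>t \<in> {..T}. (\<lambda>(r, c). (t, r, c)) ` ({..Suc (height (lam t))} \<times> {..Suc (width (lam t))}))"
  proof
    fix u assume "u \<in> {u. addable \<kappa> i lam u \<and> fst u \<le> T}"
    then obtain t r c where u: "u = (t, r, c)" "t \<le> T" and a: "addable \<kappa> i lam (t, r, c)"
      by (cases u) auto
    have Y: "young_diagram (lam t)" using multipartition_young[OF assms] .
    have "r \<le> Suc (height (lam t))"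
      using a young_diagram_downD[OF Y, of "r - 1" c "r - 1" 1] mem_col_1[OF Y, of "r - 1"]
      unfolding addable_iff[OF assms] by (cases "r = 1") auto
    moreover have "c \<le> Suc (width (lam t))"
      using a young_diagram_downD[OF Y, of r "c - 1" 1 "c - 1"] mem_row_1[OF Y, of "c - 1"]
      unfolding addable_iff[OF assms] by (cases "c = 1") auto
    ultimately show "u \<in> (\<Union>t \<in> {..T}. (\<lambda>(r, c). (t, r, c)) `
        ({..Suc (height (lam t))} \<times> {..Suc (width (lam t))}))"
      using u by auto
  qed
  then show ?thesis by (rule finite_subset) auto
qed

lemma removable_not_addable: "removable \<kappa> i lam u \<Longrightarrow> \<not> addable \<kappa> i lam u"
  by (simp add: removable_def addable_def)

lemma above_trans: "above u v \<Longrightarrow> above v w \<Longrightarrow> above u w"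
  by (auto simp: above_def)

lemma above_irrefl [simp]: "\<not> above u u"
  by (auto simp: above_def)

abbreviation signature_box :: "multicharge \<Rightarrow> bit \<Rightarrow> multidiagram \<Rightarrow> box \<Rightarrow> bool" where
  "signature_box \<kappa> i lam w \<equiv> removable \<kappa> i lam w \<or> addable \<kappa> i lam w"

text \<open>
  Two boxes in the same row that are removable or addable are adjacent, so their residues differ.
\<close>

lemma above_total:
  assumes "multipartition lam" "signature_box \<kappa> i lam u" "signature_box \<kappa> i lam v" "u \<noteq> v"
  shows "above u v \<or> above v u"
proof (rule ccontr)
  assume n: "\<not> (above u v \<or> above v u)"
  obtain t r c where u: "u = (t, r, c)" by (cases u)
  obtain t' r' c' where v: "v = (t', r', c')" by (cases v)
  have eq: "t' = t" "r' = r" using n by (auto simp: u v above_def)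
  have Y: "young_diagram (lam t)" using multipartition_young[OF assms(1)] .
  have no: False
    if s: "signature_box \<kappa> i lam (t, r, a)" "signature_box \<kappa> i lam (t, r, b)" and "a < b" for a b
  proof -
    have "1 \<le> r" "1 \<le> a" using s young_diagram_boxD[OF Y]
      unfolding addable_iff[OF assms(1)] removable_iff[OF assms(1)] by auto
    have "(r, b - 1) \<in> lam t"
      using s(2) young_diagram_downD[OF Y, of r b r "b - 1"] \<open>1 \<le> r\<close> \<open>1 \<le> a\<close> \<open>a < b\<close>
      unfolding addable_iff[OF assms(1)] removable_iff[OF assms(1)] by auto
    then have a: "(r, a) \<in> lam t"
      using young_diagram_downD[OF Y, of r "b - 1" r a] \<open>1 \<le> r\<close> \<open>1 \<le> a\<close> \<open>a < b\<close> by auto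
    then have R: "(r, Suc a) \<notin> lam t" "\<kappa> t + of_nat a - of_nat r = i"
      using s(1) unfolding addable_iff[OF assms(1)] removable_iff[OF assms(1)] by auto
    then have "(r, b') \<notin> lam t" if "a < b'" for b'
      using young_diagram_downD[OF Y, of r b' r "Suc a"] that \<open>1 \<le> r\<close> by auto
    then have "(r, b) \<notin> lam t" "\<not> a < b - 1" using \<open>a < b\<close> \<open>(r, b - 1) \<in> lam t\<close> by auto
    then have "b = Suc a" using \<open>a < b\<close> by auto
    moreover have "\<kappa> t + of_nat b - of_nat r = i"
      using s(2) unfolding addable_iff[OF assms(1)] removable_iff[OF assms(1)] by auto
    ultimately have "\<kappa> t + of_nat (Suc a) - of_nat r = \<kappa> t + of_nat a - of_nat r"
      using R(2) by simp
    then have "even (Suc a + r + a + r)" unfolding residue_eq_iff by blast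
    then show False by presburger
  qed
  have "c < c' \<or> c' < c" using assms(4) u v eq by auto
  then show False using no[of c c'] no[of c' c] assms(2,3) u v eq by auto
qed

section \<open>The arc arrangement\<close>

lemma above_strict: "asymp_on S above" "transp_on S above"
  using above_trans above_irrefl unfolding asymp_on_def transp_on_def by blast+

definition maximal_arcs :: "multicharge \<Rightarrow> bit \<Rightarrow> multidiagram \<Rightarrow> (box \<times> box) set \<Rightarrow> bool" where
  "maximal_arcs \<kappa> i lam A \<longleftrightarrow> partial_arcs \<kappa> i lam A \<and> (\<nexists>u v. can_draw_arc \<kappa> i lam A u v)"

text \<open>
  A word in the letters removable and addable, read from top to bottom, cancels to
  addables followed by removables. The good boxes are the two letters at the seam: the lowest
  surviving addable box, which \<^const>\<open>f_op\<close> adds, and the highest surviving removable box.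
\<close>

definition good_removable :: "multicharge \<Rightarrow> bit \<Rightarrow> multidiagram \<Rightarrow> box \<Rightarrow> bool" where
  "good_removable \<kappa> i lam u \<longleftrightarrow>
     removable \<kappa> i lam u \<and> u \<notin> Field (arc_arrangement \<kappa> i lam) \<and>
     (\<forall>v. removable \<kappa> i lam v \<and> v \<notin> Field (arc_arrangement \<kappa> i lam) \<and> v \<noteq> u \<longrightarrow> above u v)"

definition good_addable :: "multicharge \<Rightarrow> bit \<Rightarrow> multidiagram \<Rightarrow> box \<Rightarrow> bool" where
  "good_addable \<kappa> i lam u \<longleftrightarrow>
     u \<in> unarced_addable \<kappa> i lam \<and> (\<forall>v \<in> unarced_addable \<kappa> i lam. v \<noteq> u \<longrightarrow> above v u)"

context
  fixes \<kappa> :: multicharge and i :: bit and lam :: multidiagram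
  assumes mp: "multipartition lam"
begin

lemma partial_arcsD:
  assumes "partial_arcs \<kappa> i lam A" "(u, v) \<in> A"
  shows "removable \<kappa> i lam u" "addable \<kappa> i lam v" "above u v"
  using assms by (induction) (auto simp: can_draw_arc_def)

lemma Field_iff: "w \<in> Field A \<longleftrightarrow> (\<exists>a b. (a, b) \<in> A \<and> (w = a \<or> w = b))"
  unfolding Field_def by blast

lemma partial_arcs_Field:
  assumes "partial_arcs \<kappa> i lam A" "w \<in> Field A"
  shows "removable \<kappa> i lam w \<Longrightarrow> \<exists>v. (w, v) \<in> A" "addable \<kappa> i lam w \<Longrightarrow> \<exists>u. (u, w) \<in> A"
proof -
  obtain a b where ab: "(a, b) \<in> A" "w = a \<or> w = b" using assms(2) unfolding Field_iff by blast
  note D = partial_arcsD[OF assms(1) ab(1)]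
  show "\<exists>v. (w, v) \<in> A" if "removable \<kappa> i lam w"
    using that ab D removable_not_addable by blast
  show "\<exists>u. (u, w) \<in> A" if "addable \<kappa> i lam w"
    using that ab D removable_not_addable by blast
qed

lemma partial_arcs_matching:
  assumes "partial_arcs \<kappa> i lam A"
  shows "(u, v) \<in> A \<Longrightarrow> (u, v') \<in> A \<Longrightarrow> v = v'" "(u, v) \<in> A \<Longrightarrow> (u', v) \<in> A \<Longrightarrow> u = u'"
  using assms
  by (induction arbitrary: u v v' u') (auto simp: can_draw_arc_def Field_def)

text \<open>
  An arc is drawn only over boxes that are already arced, so arcs are nested or disjoint.
\<close>

lemma partial_arcs_noncrossing:
  assumes "partial_arcs \<kappa> i lam A" "(u, v) \<in> A" "signature_box \<kappa> i lam w" "above u w" "above w v"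
  shows "\<exists>a b. (a, b) \<in> A \<and> (w = a \<or> w = b) \<and> above u a \<and> above b v"
  using assms
proof (induction arbitrary: u v w)
  case (draw_arc A u0 v0)
  note draw = draw_arc.hyps(2)[unfolded can_draw_arc_def]
  show ?case
  proof (cases "(u, v) \<in> A")
    case True
    then show ?thesis using draw_arc by blast
  next
    case False
    then have uv: "u = u0" "v = v0" using draw_arc.prems by auto
    then have "w \<in> Field A" using draw draw_arc.prems by blast
    then obtain a b where ab: "(a, b) \<in> A" "w = a \<or> w = b" unfolding Field_iff by blast
    note abD = partial_arcsD[OF draw_arc.hyps(1) ab(1)]
    have noteq: "a \<noteq> u" "b \<noteq> v" using ab draw uv unfolding Field_iff by blast+
    have "above u a"
    proof (rule ccontr)
      assume "\<not> above u a"
      then have "above a u" using above_total[OF mp, of \<kappa> i a u] noteq abD draw uv by auto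
      moreover have "above u b" using ab draw_arc.prems abD \<open>\<not> above u a\<close> by auto
      ultimately have "u \<in> Field A"
        using draw_arc.IH[OF ab(1), of u] draw uv unfolding Field_iff by blast
      then show False using draw uv by blast
    qed
    moreover have "above b v"
    proof (rule ccontr)
      assume "\<not> above b v"
      then have "above v b" using above_total[OF mp, of \<kappa> i v b] noteq abD draw uv by auto
      moreover have "above a v" using ab draw_arc.prems abD \<open>\<not> above b v\<close> by auto
      ultimately have "v \<in> Field A"
        using draw_arc.IH[OF ab(1), of v] draw uv unfolding Field_iff by blast
      then show False using draw uv by blast
    qed
    ultimately show ?thesis using ab by blast
  qed
qed auto

text \<open>
  Independence of the order of drawing: by induction, every arc ever drawn belongs to each maximal
  arrangement. If the next arc of \<open>A\<close> from \<open>u\<close> to \<open>v\<close> were missing from \<open>B\<close>, then neither \<open>u\<close> nor \<open>v\<close> could be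
  arced in \<open>B\<close> differently without crossing an arc of \<open>A\<close> or stealing one of its ends, so \<open>B\<close> could
  be enlarged.
\<close>

lemma partial_arcs_subset_maximal:
  assumes "partial_arcs \<kappa> i lam A" "maximal_arcs \<kappa> i lam B"
  shows "A \<subseteq> B"
  using assms(1)
proof induction
  case (draw_arc A u v)
  note draw = draw_arc.hyps(2)[unfolded can_draw_arc_def]
  have B: "partial_arcs \<kappa> i lam B" "\<not> can_draw_arc \<kappa> i lam B u v"
    using assms(2) unfolding maximal_arcs_def by blast+
  note uniq = partial_arcs_matching[OF B(1)]
  have between: "\<exists>a b. (a, b) \<in> A \<and> (a, b) \<in> B \<and> (w = a \<or> w = b)"
    if "signature_box \<kappa> i lam w" "above u w" "above w v" for w
    using that draw draw_arc.IH unfolding Field_iff by blast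
  have no_arc_below: False if uv': "(u, v') \<in> B" "v' \<noteq> v" for v'
  proof -
    note D = partial_arcsD[OF B(1) uv'(1)]
    consider "above v' v" | "above v v'" using above_total[OF mp, of \<kappa> i v v'] D draw uv' by auto
    then show False
    proof cases
      case 1
      then obtain a b where "(a, b) \<in> A" "(a, b) \<in> B" "v' = a \<or> v' = b"
        using between[of v'] D by blast
      then have "(u, v') \<in> A"
        using D uniq(2)[OF uv'(1)] partial_arcsD[OF B(1)] removable_not_addable by blast
      then show False using draw unfolding Field_iff by blast
    next
      case 2
      then obtain a b where ab: "(a, b) \<in> B" "v = a \<or> v = b" "above u a"
        using partial_arcs_noncrossing[OF B(1) uv'(1), of v] draw by blast
      then have "b = v" using draw partial_arcsD[OF B(1)] removable_not_addable by blast
      then obtain b' where "(a, b') \<in> A" "(a, b') \<in> B"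
        using between[of a] ab partial_arcsD[OF B(1) ab(1)] partial_arcsD[OF B(1)]
          removable_not_addable by blast
      then have "(a, v) \<in> A" using uniq(1) ab \<open>b = v\<close> by blast
      then show False using draw unfolding Field_iff by blast
    qed
  qed
  have no_arc_above: False if uv': "(u', v) \<in> B" "u' \<noteq> u" for u'
  proof -
    note D = partial_arcsD[OF B(1) uv'(1)]
    consider "above u u'" | "above u' u" using above_total[OF mp, of \<kappa> i u u'] D draw uv' by auto
    then show False
    proof cases
      case 1
      then obtain a b where "(a, b) \<in> A" "(a, b) \<in> B" "u' = a \<or> u' = b"
        using between[of u'] D by blast
      then have "(u', v) \<in> A"
        using D uniq(1)[OF uv'(1)] partial_arcsD[OF B(1)] removable_not_addable by blast
      then show False using draw unfolding Field_iff by blast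
    next
      case 2
      then obtain a b where ab: "(a, b) \<in> B" "u = a \<or> u = b" "above b v"
        using partial_arcs_noncrossing[OF B(1) uv'(1), of u] draw by blast
      then have "u \<noteq> b"
        using draw partial_arcsD(2)[OF B(1) ab(1)] removable_not_addable by blast
      then have "(u, b) \<in> B" "b \<noteq> v"
        using ab above_irrefl by blast+
      then show False using no_arc_below by blast
    qed
  qed
  have "(u, v) \<in> B"
  proof (rule ccontr)
    assume n: "(u, v) \<notin> B"
    have "u \<notin> Field B"
      using n no_arc_below partial_arcs_Field(1)[OF B(1), of u] draw by blast
    moreover have "v \<notin> Field B"
      using n no_arc_above partial_arcs_Field(2)[OF B(1), of v] draw by blast
    moreover have "\<forall>w. signature_box \<kappa> i lam w \<and> above u w \<and> above w v \<longrightarrow> w \<in> Field B"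
      using between unfolding Field_iff by blast
    ultimately show False using B(2) draw unfolding can_draw_arc_def by blast
  qed
  then show ?case using draw_arc.IH by auto
qed auto

lemma finite_card_partial_arcs:
  assumes "partial_arcs \<kappa> i lam A"
  shows "finite A" "card A \<le> card {u. removable \<kappa> i lam u}"
proof -
  show "finite A" using assms by induction auto
  have "inj_on fst A" using partial_arcs_matching(1)[OF assms] by (auto simp: inj_on_def)
  moreover have "fst ` A \<subseteq> {u. removable \<kappa> i lam u}" using partial_arcsD[OF assms] by auto
  ultimately show "card A \<le> card {u. removable \<kappa> i lam u}"
    using card_inj_on_le finite_removable[OF mp] by blast
qed

lemma ex_maximal_arcs: "\<exists>A. maximal_arcs \<kappa> i lam A"
proof -
  let ?P = "\<lambda>n. \<exists>A. partial_arcs \<kappa> i lam A \<and> card A = n"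
  have "?P 0" using no_arcs by (intro exI[of _ "{}"]) auto
  moreover have "\<forall>n. ?P n \<longrightarrow> n \<le> card {u. removable \<kappa> i lam u}"
    using finite_card_partial_arcs by blast
  ultimately obtain n where n: "?P n" "\<forall>m. ?P m \<longrightarrow> m \<le> n"
    using Nat.ex_has_greatest_nat[of ?P 0] by blast
  then obtain A where A: "partial_arcs \<kappa> i lam A" "card A = n" by blast
  have "\<not> can_draw_arc \<kappa> i lam A u v" for u v
  proof
    assume c: "can_draw_arc \<kappa> i lam A u v"
    then have "card (insert (u, v) A) = Suc n"
      using A finite_card_partial_arcs(1)[OF A(1)]
      by (subst card_insert_disjoint) (auto simp: can_draw_arc_def Field_def)
    then show False using n(2) draw_arc[OF A(1) c] by fastforce
  qed
  then show ?thesis using A unfolding maximal_arcs_def by blast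
qed

lemma arc_arrangement_eq: "maximal_arcs \<kappa> i lam A \<Longrightarrow> arc_arrangement \<kappa> i lam = A"
  unfolding arc_arrangement_def maximal_arcs_def[symmetric]
  using partial_arcs_subset_maximal by (intro the_equality) (auto simp: maximal_arcs_def)

lemma maximal_arc_arrangement: "maximal_arcs \<kappa> i lam (arc_arrangement \<kappa> i lam)"
  using ex_maximal_arcs arc_arrangement_eq by metis

lemma partial_arc_arrangement: "partial_arcs \<kappa> i lam (arc_arrangement \<kappa> i lam)"
  using maximal_arc_arrangement by (simp add: maximal_arcs_def)

text \<open>
  If an unarced removable box lies above an unarced addable one and no arc can be drawn
  between them, there is an unarced box strictly in between, which forms such a pair with one of
  the two ends and has fewer boxes in between. This cannot go on forever.
\<close>

lemma no_unarced_removable_above_addable: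
  assumes "removable \<kappa> i lam u" "u \<notin> Field (arc_arrangement \<kappa> i lam)"
    and "addable \<kappa> i lam v" "v \<notin> Field (arc_arrangement \<kappa> i lam)"
  shows "\<not> above u v"
proof
  assume uv: "above u v"
  let ?F = "Field (arc_arrangement \<kappa> i lam)"
  let ?S = "\<lambda>u v. {w. signature_box \<kappa> i lam w \<and> above u w \<and> above w v}"
  have fin: "finite (?S u v)" for u v
  proof (rule finite_subset)
    show "?S u v \<subseteq> {w. removable \<kappa> i lam w} \<union> {w. addable \<kappa> i lam w \<and> fst w \<le> fst u}"
      by (auto simp: above_def)
    show "finite \<dots>" using finite_removable[OF mp] finite_addable_upto[OF mp] by simp
  qed
  have "False" if "removable \<kappa> i lam u" "u \<notin> ?F" "addable \<kappa> i lam v" "v \<notin> ?F" "above u v" for u v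
    using that
  proof (induction "card (?S u v)" arbitrary: u v rule: less_induct)
    case less
    have "\<not> can_draw_arc \<kappa> i lam (arc_arrangement \<kappa> i lam) u v"
      using maximal_arc_arrangement unfolding maximal_arcs_def by blast
    then obtain w where w: "w \<in> ?S u v" "w \<notin> ?F"
      using less.prems unfolding can_draw_arc_def by blast
    have "?S u w \<subset> ?S u v" "?S w v \<subset> ?S u v"
      using w above_trans above_irrefl by blast+
    then have "card (?S u w) < card (?S u v)" "card (?S w v) < card (?S u v)"
      using psubset_card_mono[OF fin] by blast+
    then show False using less w by blast
  qed
  then show False using assms uv by blast
qed

lemma good_addable_unique:
  assumes "good_addable \<kappa> i lam u" "good_addable \<kappa> i lam v" shows "u = v"
proof (rule ccontr)
  assume "u \<noteq> v"
  then have "above v u" "above u v" using assms unfolding good_addable_def by auto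
  then show False using above_trans[of u v u] by simp
qed

lemma f_op_eq: "good_addable \<kappa> i lam u \<Longrightarrow> f_op \<kappa> i lam = add_box u lam"
  unfolding f_op_def good_addable_def[symmetric]
  using good_addable_unique by (metis the_equality)

lemma good_addableD: "good_addable \<kappa> i lam u \<Longrightarrow> addable \<kappa> i lam u"
  by (simp add: good_addable_def unarced_addable_def)

lemma good_removableD: "good_removable \<kappa> i lam u \<Longrightarrow> removable \<kappa> i lam u"
  by (simp add: good_removable_def)

text \<open>
  This lemma and its dual are all that the closure arguments need to know about arcs: an addable
  box below the good one must have been cancelled by a removable box, and that box lies below the
  good one because no arc passes over an unarced box.
\<close>

lemma removable_below_good_addable:
  assumes "good_addable \<kappa> i lam u" "addable \<kappa> i lam v" "above u v"
  shows "\<exists>w. removable \<kappa> i lam w \<and> above u w \<and> above w v"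
proof -
  let ?A = "arc_arrangement \<kappa> i lam"
  have u: "addable \<kappa> i lam u" "u \<notin> Field ?A"
    using assms by (auto simp: good_addable_def unarced_addable_def)
  have "v \<in> Field ?A"
    using assms above_trans[of u v u] unfolding good_addable_def unarced_addable_def by fastforce
  then obtain w where w: "(w, v) \<in> ?A"
    using partial_arcs_Field(2)[OF partial_arc_arrangement] assms by blast
  note wD = partial_arcsD[OF partial_arc_arrangement w]
  have "\<not> above w u"
    using partial_arcs_noncrossing[OF partial_arc_arrangement w, of u] assms u
    unfolding Field_iff by blast
  then have "above u w"
    using above_total[OF mp, of \<kappa> i u w] wD u removable_not_addable by blast
  then show ?thesis using wD by blast
qed

lemma addable_above_good_removable:
  assumes "good_removable \<kappa> i lam u" "removable \<kappa> i lam v" "above v u"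
  shows "\<exists>w. addable \<kappa> i lam w \<and> above v w \<and> above w u"
proof -
  let ?A = "arc_arrangement \<kappa> i lam"
  have u: "removable \<kappa> i lam u" "u \<notin> Field ?A"
    using assms by (auto simp: good_removable_def)
  have "v \<in> Field ?A"
    using assms above_trans[of u v u] unfolding good_removable_def by fastforce
  then obtain w where w: "(v, w) \<in> ?A"
    using partial_arcs_Field(1)[OF partial_arc_arrangement] assms by blast
  note wD = partial_arcsD[OF partial_arc_arrangement w]
  have "\<not> above u w"
    using partial_arcs_noncrossing[OF partial_arc_arrangement w, of u] assms u
    unfolding Field_iff by blast
  then have "above w u"
    using above_total[OF mp, of \<kappa> i u w] wD u removable_not_addable by blast
  then show ?thesis using wD by blast
qed

text \<open>
  Infinitely many empty components of charge \<open>i\<close> each offer an \<open>i\<close>-addable box, and there are only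
  finitely many arcs.
\<close>

lemma ex_good_addable:
  assumes "multicharge \<kappa>"
  shows "\<exists>u. good_addable \<kappa> i lam u"
proof -
  let ?A = "arc_arrangement \<kappa> i lam"
  obtain N where N: "\<forall>t > N. lam t = {}" using mp by (auto simp: multipartition_def)
  have fin: "finite (fst ` Field ?A)"
    using finite_card_partial_arcs(1)[OF partial_arc_arrangement] by (simp add: finite_Field)
  have "infinite {t. 1 \<le> t \<and> \<kappa> t = i}" using assms by (cases i) (auto simp: multicharge_def)
  then have "infinite ({t. 1 \<le> t \<and> \<kappa> t = i} - {..N} - fst ` Field ?A)" using fin by simp
  from infinite_imp_nonempty[OF this]
  obtain t where "t \<in> {t. 1 \<le> t \<and> \<kappa> t = i} - {..N} - fst ` Field ?A" by blast
  then have t: "1 \<le> t" "\<kappa> t = i" "N < t" "t \<notin> fst ` Field ?A" by auto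
  have "(t, 1, 1) \<in> unarced_addable \<kappa> i lam"
    using t N addable_iff[OF mp, of \<kappa> i t 1 1] image_eqI[of t fst "(t, Suc 0, Suc 0)"]
    unfolding unarced_addable_def by (auto simp del: add_bit_eq_xor)
  then obtain u0 where u0: "u0 \<in> unarced_addable \<kappa> i lam" by blast
  define S where "S = {u \<in> unarced_addable \<kappa> i lam. fst u \<le> fst u0}"
  have "finite S"
    by (rule finite_subset[OF _ finite_addable_upto[OF mp, of \<kappa> i "fst u0"]])
       (auto simp: S_def unarced_addable_def)
  moreover have "u0 \<in> S" using u0 by (simp add: S_def)
  ultimately obtain u where u: "u \<in> S" "\<forall>v \<in> S. v \<noteq> u \<longrightarrow> \<not> above u v"
    using Finite_Set.bex_max_element[OF _ above_strict] by blast
  have u': "addable \<kappa> i lam u" "fst u \<le> fst u0" "u \<in> unarced_addable \<kappa> i lam"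
    using u(1) by (auto simp: S_def unarced_addable_def)
  have "above v u" if v: "v \<in> unarced_addable \<kappa> i lam" "v \<noteq> u" for v
  proof (cases "v \<in> S")
    case True
    then show ?thesis
      using above_total[OF mp, of \<kappa> i v u] u(2) u' v by (auto simp: unarced_addable_def)
  next
    case False
    then show ?thesis using u' v by (auto simp: S_def above_def split: prod.splits)
  qed
  then show ?thesis using u' unfolding good_addable_def by blast
qed

lemma ex_good_removable:
  assumes "removable \<kappa> i lam u" "u \<notin> Field (arc_arrangement \<kappa> i lam)"
  shows "\<exists>u. good_removable \<kappa> i lam u"
proof -
  define S where "S = {u. removable \<kappa> i lam u \<and> u \<notin> Field (arc_arrangement \<kappa> i lam)}"
  have "finite S"
    by (rule finite_subset[OF _ finite_removable[OF mp, of \<kappa> i]]) (auto simp: S_def)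
  moreover have "u \<in> S" using assms by (simp add: S_def)
  ultimately obtain u' where u': "u' \<in> S" "\<forall>v \<in> S. v \<noteq> u' \<longrightarrow> \<not> above v u'"
    using Finite_Set.bex_min_element[OF _ above_strict] by blast
  have "above u' v" if "v \<in> S" "v \<noteq> u'" for v
    using above_total[OF mp, of \<kappa> i u' v] u' that unfolding S_def by blast
  then show ?thesis using u'(1) unfolding good_removable_def S_def by blast
qed

end

text \<open>
  The neighbours of a box of residue \<open>i\<close> have the other residue, so removing an \<open>i\<close>-removable box
  changes the status of no other box of residue \<open>i\<close>.
\<close>

lemma signature_remove_box:
  assumes mp: "multipartition lam" and u: "removable \<kappa> i lam u"
  shows "removable \<kappa> i (remove_box u lam) w \<longleftrightarrow> removable \<kappa> i lam w \<and> w \<noteq> u" (is ?R)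
    and "addable \<kappa> i (remove_box u lam) w \<longleftrightarrow> addable \<kappa> i lam w \<or> w = u" (is ?A)
proof -
  obtain t r c where ueq: "u = (t, r, c)" by (cases u)
  obtain t' r' c' where weq: "w = (t', r', c')" by (cases w)
  let ?mu = "remove_box u lam"
  have mp': "multipartition ?mu" using u by (simp add: removable_def)
  have mem: "(a, b) \<in> ?mu s \<longleftrightarrow> (a, b) \<in> lam s \<and> (s, a, b) \<noteq> u" for s a b
    by (auto simp: remove_box_def ueq)
  have uD: "(r, c) \<in> lam t" "\<kappa> t + of_nat c - of_nat r = i" "(Suc r, c) \<notin> lam t" "(r, Suc c) \<notin> lam t"
    using u unfolding ueq removable_iff[OF mp] by auto
  have Y: "young_diagram (lam t)" using multipartition_young[OF mp] .
  have pos: "1 \<le> r" "1 \<le> c" "1 \<le> t"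
    using young_diagram_boxD[OF Y uD(1)] uD(1) multipartition_0[OF mp] by (cases t; auto)+
  have ne: "(t', a, b) \<noteq> u" if "\<kappa> t' + of_nat c' - of_nat r' = i" "odd (a + b + r' + c')" for a b
  proof
    assume "(t', a, b) = u"
    then have eq: "t' = t" "a = r" "b = c" by (auto simp: ueq)
    have "\<kappa> t + of_nat c' - of_nat r' = \<kappa> t + of_nat c - of_nat r"
      using that(1) uD(2) eq(1) by metis
    then have "even (c' + r' + b + a)" unfolding residue_eq_iff eq by blast
    then show False using that(2) by presburger
  qed
  show ?R
  proof (cases "\<kappa> t' + of_nat c' - of_nat r' = i")
    case True
    have "(t', Suc r', c') \<noteq> u" "(t', r', Suc c') \<noteq> u" by (rule ne[OF True]; presburger)+
    then show ?thesis
      unfolding weq removable_iff[OF mp] removable_iff[OF mp'] mem by auto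
  qed (simp add: weq removable_iff[OF mp] removable_iff[OF mp'] del: add_bit_eq_xor)
  show ?A
  proof (cases "\<kappa> t' + of_nat c' - of_nat r' = i")
    case True
    have 1: "(t', r' - 1, c') \<noteq> u" if "1 \<le> r'"
      by (rule ne[OF True]) (use that in presburger)
    have 2: "(t', r', c' - 1) \<noteq> u" if "1 \<le> c'"
      by (rule ne[OF True]) (use that in presburger)
    have 3: "r = 1 \<or> (r - 1, c) \<in> lam t" "c = 1 \<or> (r, c - 1) \<in> lam t"
      using young_diagram_downD[OF Y uD(1), of "r - 1" c] young_diagram_downD[OF Y uD(1), of r "c - 1"]
        pos by (cases "r = 1"; cases "c = 1"; force)+
    show ?thesis
    proof (cases "w = u")
      case True
      then have "t' = t" "r' = r" "c' = c" by (auto simp: weq ueq)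
      then show ?thesis
        using 1 2 3 pos uD(2) True unfolding weq addable_iff[OF mp'] mem by blast
    next
      case False
      then show ?thesis
        using 1 2 unfolding weq addable_iff[OF mp] addable_iff[OF mp'] mem by blast
    qed
  next
    case False
    then have "w \<noteq> u" using uD(2) weq ueq by blast
    then show ?thesis
      using False unfolding weq addable_iff[OF mp] addable_iff[OF mp'] by blast
  qed
qed

text \<open>
  Removing the good removable box \<open>u\<close> turns one letter of the word from removable to addable, and the
  arcs stay the same: a new arc would have to end at \<open>u\<close> and begin at an unarced removable box above
  it. Since every unarced addable box was above \<open>u\<close>, the box \<open>u\<close> is now the lowest one.
\<close>

lemma good_removable_imp_good_addable:
  assumes mp: "multipartition lam" and good: "good_removable \<kappa> i lam u"
  shows "good_addable \<kappa> i (remove_box u lam) u"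
proof -
  let ?mu = "remove_box u lam" and ?A = "arc_arrangement \<kappa> i lam"
  have u: "removable \<kappa> i lam u" "u \<notin> Field ?A"
    "\<And>v. removable \<kappa> i lam v \<Longrightarrow> v \<notin> Field ?A \<Longrightarrow> v \<noteq> u \<Longrightarrow> above u v"
    using good by (auto simp: good_removable_def)
  note sig = signature_remove_box[OF mp u(1)]
  have mp': "multipartition ?mu" using u(1) by (simp add: removable_def)
  have "u \<notin> Field A \<Longrightarrow> partial_arcs \<kappa> i ?mu A" if "partial_arcs \<kappa> i lam A" for A
    using that
  proof induction
    case (draw_arc A v w)
    have "u \<notin> Field A" "v \<noteq> u" "w \<noteq> u" using draw_arc.prems unfolding Field_insert by auto
    then have "can_draw_arc \<kappa> i ?mu A v w"
      using draw_arc.hyps(2) u(1) unfolding can_draw_arc_def sig by blast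
    then show ?case using draw_arc.IH \<open>u \<notin> Field A\<close> partial_arcs.draw_arc by blast
  qed (rule no_arcs)
  then have "partial_arcs \<kappa> i ?mu ?A" using partial_arc_arrangement[OF mp] u(2) by blast
  moreover have "\<not> can_draw_arc \<kappa> i ?mu ?A v w" for v w
  proof
    assume c: "can_draw_arc \<kappa> i ?mu ?A v w"
    then have "removable \<kappa> i lam v" "v \<noteq> u" "v \<notin> Field ?A" "above v w"
      unfolding can_draw_arc_def sig by blast+
    then have "w \<noteq> u" using u(3)[of v] above_trans[of u v u] by auto
    then have "can_draw_arc \<kappa> i lam ?A v w"
      using c u(1) unfolding can_draw_arc_def sig by blast
    then show False
      using maximal_arc_arrangement[OF mp] unfolding maximal_arcs_def by blast
  qed
  ultimately have "maximal_arcs \<kappa> i ?mu ?A" unfolding maximal_arcs_def by blast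
  then have A: "arc_arrangement \<kappa> i ?mu = ?A" by (rule arc_arrangement_eq[OF mp'])
  have "above v u" if v: "v \<in> unarced_addable \<kappa> i ?mu" "v \<noteq> u" for v
  proof -
    have a: "addable \<kappa> i lam v" "v \<notin> Field ?A"
      using v unfolding unarced_addable_def A sig by auto
    then have "\<not> above u v"
      using no_unarced_removable_above_addable[OF mp u(1,2)] by blast
    then show ?thesis using above_total[OF mp, of \<kappa> i u v] u(1) a v(2) by blast
  qed
  moreover have "u \<in> unarced_addable \<kappa> i ?mu"
    using u(2) unfolding unarced_addable_def A sig by simp
  ultimately show ?thesis unfolding good_addable_def by blast
qed

lemma f_op_remove_good:
  assumes mp: "multipartition lam" and good: "good_removable \<kappa> i lam u"
  shows "f_op \<kappa> i (remove_box u lam) = lam"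
proof -
  have u: "removable \<kappa> i lam u" using good_removableD[OF mp good] .
  have "f_op \<kappa> i (remove_box u lam) = add_box u (remove_box u lam)"
    using f_op_eq[OF _ good_removable_imp_good_addable[OF mp good]] u by (simp add: removable_def)
  also have "\<dots> = lam"
    using u by (auto simp: add_box_def remove_box_def removable_def boxes_def insert_absorb
        split: prod.splits)
  finally show ?thesis .
qed

section \<open>The boundary between neighbouring components\<close>

lemma above_iff: "above (t, r, c) (t', r', c') \<longleftrightarrow> t' < t \<or> t' = t \<and> r < r'"
  by (auto simp: above_def)

lemma row_le_height:
  assumes "young_diagram D" "(r, c) \<in> D" shows "r \<le> height D"
  using young_diagram_boxD[OF assms] young_diagram_downD[OF assms, of r "Suc 0"] mem_col_1[OF assms(1), of r]
  by auto

lemma two_restrictedD: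
  assumes "young_diagram D" "two_restricted D" "(r, Suc c) \<in> D" "1 \<le> c"
  shows "(Suc r, c) \<in> D"
  using assms two_restricted_iff by blast

lemma addable_row_1:
  assumes "multipartition lam" "1 \<le> t"
  shows "addable \<kappa> i lam (t, Suc 0, Suc (width (lam t))) \<longleftrightarrow>
    \<kappa> t + of_nat (Suc (width (lam t))) - of_nat (Suc 0) = i"
  unfolding addable_iff[OF assms(1)] mem_row_1[OF multipartition_young[OF assms(1)]]
  using assms(2) by (cases "width (lam t)") (auto simp del: add_bit_eq_xor)

lemma removable_col_1:
  assumes "multipartition lam" "two_restricted (lam t)" "lam t \<noteq> {}"
  shows "removable \<kappa> i lam (t, height (lam t), Suc 0) \<longleftrightarrow>
    \<kappa> t + of_nat (Suc 0) - of_nat (height (lam t)) = i"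
proof -
  have Y: "young_diagram (lam t)" using multipartition_young[OF assms(1)] .
  have h: "1 \<le> height (lam t)" using height_eq_0_iff[OF Y] assms(3) by linarith
  have "(height (lam t), Suc (Suc 0)) \<notin> lam t"
    using two_restrictedD[OF Y assms(2), of "height (lam t)" "Suc 0"] mem_col_1[OF Y] by auto
  then show ?thesis
    unfolding removable_iff[OF assms(1)] mem_col_1[OF Y] using h by auto
qed

lemma addable_below_height:
  assumes "multipartition lam" "addable \<kappa> i lam (t, r, c)" "height (lam t) < r"
  shows "r = Suc (height (lam t)) \<and> c = Suc 0"
proof -
  have Y: "young_diagram (lam t)" using multipartition_young[OF assms(1)] .
  note a = assms(2)[unfolded addable_iff[OF assms(1)]]
  have "r = Suc (height (lam t))"
    using a row_le_height[OF Y, of "r - 1" c] assms(3) by (cases "r = 1") auto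
  moreover have "c = 1" using a row_le_height[OF Y, of r "c - 1"] assms(3) by auto
  ultimately show ?thesis by simp
qed

lemma addable_empty:
  assumes "multipartition lam" "addable \<kappa> i lam (t, r, c)" "lam t = {}"
  shows "r = Suc 0" "c = Suc 0" "\<kappa> t = i"
  using assms unfolding addable_iff[OF assms(1)] by auto

text \<open>
  The gap measures how far apart the first row of a component and the first column of the next
  higher one are, normalised so that its parity decides whether the box addable to that row and the
  one addable to that column have equal residues.
\<close>

definition gap :: "multicharge \<Rightarrow> multidiagram \<Rightarrow> nat \<Rightarrow> int" where
  "gap \<kappa> lam t =
     int (width (lam t)) - int (height (lam (Suc t))) - of_bool (\<kappa> t = \<kappa> (Suc t))"

lemma odd_gap_iff:
  "odd (gap \<kappa> lam t) \<longleftrightarrow>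
     \<kappa> t + of_nat (Suc (width (lam t))) - of_nat (Suc 0) =
     \<kappa> (Suc t) + of_nat (Suc 0) - of_nat (Suc (height (lam (Suc t))))"
  unfolding residue_eq_iff gap_def by (cases "\<kappa> t = \<kappa> (Suc t)") auto

lemma gap_add_box:
  assumes mp: "multipartition lam" and u: "addable \<kappa> i lam (t0, r, c)"
  shows "gap \<kappa>' (add_box (t0, r, c) lam) t =
    gap \<kappa>' lam t + of_bool (t = t0 \<and> r = 1) - of_bool (Suc t = t0 \<and> c = 1)"
proof -
  have "multipartition (add_box (t0, r, c) lam)" using u by (simp add: addable_def)
  then have "young_diagram (add_box (t0, r, c) lam t0)" by (rule multipartition_young)
  then have Y: "young_diagram (lam t0)" "(r, c) \<notin> lam t0" "young_diagram (insert (r, c) (lam t0))"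
    using multipartition_young[OF mp] u by (auto simp: addable_def boxes_def add_box_def)
  show ?thesis
    using width_insert(1)[OF Y] height_insert(1)[OF Y] by (auto simp: gap_def add_box_def)
qed

text \<open>
  For an odd gap the box addable to the first row of component \<open>t\<close> directly follows the given box in
  the word, so the given one is not the lowest surviving addable box. Hence an odd gap never drops
  when a good box is added.
\<close>

lemma good_addable_not_at_odd_gap:
  assumes mp: "multipartition lam" and good: "good_addable \<kappa> i lam (Suc t, r, Suc 0)" and "1 \<le> t"
  shows "even (gap \<kappa> lam t)"
proof (rule ccontr)
  assume odd: "odd (gap \<kappa> lam t)"
  let ?h = "height (lam (Suc t))" and ?w = "width (lam t)"
  have Y: "young_diagram (lam s)" for s using multipartition_young[OF mp] .
  note a = good_addableD[OF mp good]
  have "?h < r"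
    using a mem_col_1[OF Y, of r "Suc t"] unfolding addable_iff[OF mp] by auto
  then have r: "r = Suc ?h" using addable_below_height[OF mp a] by simp
  have "\<kappa> (Suc t) + of_nat (Suc 0) - of_nat (Suc ?h) = i"
    using a unfolding addable_iff[OF mp] r by blast
  then have "addable \<kappa> i lam (t, Suc 0, Suc ?w)"
    using odd unfolding addable_row_1[OF mp \<open>1 \<le> t\<close>] odd_gap_iff by metis
  moreover have "above (Suc t, r, Suc 0) (t, Suc 0, Suc ?w)" by (simp add: above_iff)
  ultimately obtain v
    where v: "removable \<kappa> i lam v" "above (Suc t, r, Suc 0) v" "above v (t, Suc 0, Suc ?w)"
    using removable_below_good_addable[OF mp good] by blast
  obtain t' r' c' where veq: "v = (t', r', c')" by (cases v)
  have mem: "(r', c') \<in> lam t'" using v(1) unfolding veq removable_iff[OF mp] by blast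
  then have "t' = Suc t" "r < r'" using v young_diagram_boxD[OF Y mem] by (auto simp: veq above_iff)
  then show False using row_le_height[OF Y mem] r by simp
qed

text \<open>
  Dually, for an odd gap the bottom box of the first column of component \<open>t + 1\<close> is removable and
  directly precedes the given box. Nonemptiness matters: an empty component has no removable box.
\<close>

lemma good_removable_not_at_odd_gap:
  assumes mp: "multipartition lam" and good: "good_removable \<kappa> i lam (t, Suc 0, c)"
    and R: "two_restricted (lam (Suc t))" and ne: "lam (Suc t) \<noteq> {}"
  shows "even (gap \<kappa> lam t)"
proof (rule ccontr)
  assume odd: "odd (gap \<kappa> lam t)"
  let ?h = "height (lam (Suc t))" and ?w = "width (lam t)"
  have Y: "young_diagram (lam s)" for s using multipartition_young[OF mp] .
  note a = good_removableD[OF mp good, unfolded removable_iff[OF mp]]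
  have c: "c = ?w" using a unfolding mem_row_1[OF Y] by auto
  have i: "\<kappa> t + of_nat ?w - of_nat (Suc 0) = i" using a c by blast
  have res: "\<kappa> (Suc t) + of_nat (Suc 0) - of_nat ?h = \<kappa> t + of_nat ?w - of_nat (Suc 0)"
    using odd unfolding odd_gap_iff residue_eq_iff by auto
  then have "removable \<kappa> i lam (Suc t, ?h, Suc 0)"
    unfolding removable_col_1[OF mp R ne] i .
  moreover have "above (Suc t, ?h, Suc 0) (t, Suc 0, c)" by (simp add: above_iff)
  ultimately obtain v
    where v: "addable \<kappa> i lam v" "above (Suc t, ?h, Suc 0) v" "above v (t, Suc 0, c)"
    using addable_above_good_removable[OF mp good] by blast
  obtain t' r' c' where veq: "v = (t', r', c')" by (cases v)
  have v1: "1 \<le> r'" "\<kappa> t' + of_nat c' - of_nat r' = i"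
    using v(1) unfolding veq addable_iff[OF mp] by blast+
  then have "t' = Suc t" "?h < r'" using v by (auto simp: veq above_iff)
  then have "r' = Suc ?h" "c' = Suc 0" using addable_below_height[OF mp] v(1) veq by blast+
  then have "\<kappa> (Suc t) + of_nat (Suc 0) - of_nat (Suc ?h) = \<kappa> (Suc t) + of_nat (Suc 0) - of_nat ?h"
    using v1(2) res i \<open>t' = Suc t\<close> by metis
  then have "even (Suc 0 + Suc ?h + Suc 0 + ?h)" unfolding residue_eq_iff by blast
  then show False by presburger
qed

section \<open>Admissible multipartitions\<close>

text \<open>
  The three conditions of the classification, freed from the level: beyond the level all components
  are empty and the conditions hold trivially.
\<close>

definition admissible :: "multicharge \<Rightarrow> multidiagram \<Rightarrow> bool" where
  "admissible \<kappa> lam \<longleftrightarrow>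
     (\<forall>t. two_restricted (lam t)) \<and>
     (\<forall>t \<ge> 1. -1 \<le> gap \<kappa> lam t) \<and>
     (\<forall>s u. 1 \<le> s \<and> s + 2 \<le> u \<and> lam u \<noteq> {} \<and> \<kappa> s \<noteq> \<kappa> (Suc s) \<and>
        (\<forall>j \<in> {Suc s..u - 1}. \<kappa> j = \<kappa> (Suc s)) \<and> \<kappa> (u - 1) \<noteq> \<kappa> u \<longrightarrow>
        (\<exists>t \<in> {s..u - 1}. 1 \<le> gap \<kappa> lam t))"

lemma admissible_two_restricted: "admissible \<kappa> lam \<Longrightarrow> two_restricted (lam t)"
  by (simp add: admissible_def)

lemma admissible_gap: "admissible \<kappa> lam \<Longrightarrow> 1 \<le> t \<Longrightarrow> -1 \<le> gap \<kappa> lam t"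
  by (simp add: admissible_def)

lemma admissible_charge_return:
  assumes "admissible \<kappa> lam" "1 \<le> s" "s + 2 \<le> u" "lam u \<noteq> {}" "\<kappa> s \<noteq> \<kappa> (Suc s)"
    "\<And>j. Suc s \<le> j \<Longrightarrow> j \<le> u - 1 \<Longrightarrow> \<kappa> j = \<kappa> (Suc s)" "\<kappa> (u - 1) \<noteq> \<kappa> u"
  obtains t where "s \<le> t" "t \<le> u - 1" "1 \<le> gap \<kappa> lam t"
proof -
  have "\<exists>t \<in> {s..u - 1}. 1 \<le> gap \<kappa> lam t"
    using assms unfolding admissible_def by (metis atLeastAtMost_iff)
  then show ?thesis using that by auto
qed

lemma bit_eq_if_both_differ: "(x :: bit) \<noteq> y \<Longrightarrow> y \<noteq> z \<Longrightarrow> x = z"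
  by (cases x; cases y; cases z) auto

text \<open>
  If adding \<open>u\<close> made two columns equally long, the box one down and one to the left of \<open>u\<close> would be
  addable with the same residue and would follow \<open>u\<close> directly in the word.
\<close>

lemma two_restricted_add_good:
  assumes mp: "multipartition lam" and adm: "two_restricted (lam t)"
    and good: "good_addable \<kappa> i lam u"
  shows "two_restricted (add_box u lam t)"
proof -
  obtain t0 r c where u: "u = (t0, r, c)" by (cases u)
  have Y: "young_diagram (lam s)" for s using multipartition_young[OF mp] .
  have a: "addable \<kappa> i lam (t0, r, c)" using good_addableD[OF mp good] u by simp
  have Y': "young_diagram (add_box u lam t)"
    using multipartition_young a unfolding u addable_def by blast
  have key: "(Suc r, b) \<in> lam t0" if "c = Suc b" "1 \<le> b" "t = t0" for b
  proof (rule ccontr)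
    assume n: "(Suc r, b) \<notin> lam t0"
    have rb: "(r, b) \<in> lam t0" "\<kappa> t0 + of_nat (Suc b) - of_nat r = i" "1 \<le> t0" "1 \<le> r"
      using a that unfolding addable_iff[OF mp] by auto
    have "\<kappa> t0 + of_nat b - of_nat (Suc r) = \<kappa> t0 + of_nat (Suc b) - of_nat r"
      unfolding residue_eq_iff by auto
    moreover have "(Suc r, b - 1) \<in> lam t0" if "b \<noteq> 1"
      using two_restrictedD[OF Y, of t0 r "b - 1"] adm rb(1) \<open>t = t0\<close> \<open>1 \<le> b\<close> that by auto
    ultimately have "addable \<kappa> i lam (t0, Suc r, b)"
      unfolding addable_iff[OF mp] using n rb \<open>1 \<le> b\<close> by auto
    moreover have "above u (t0, Suc r, b)" by (simp add: above_iff u)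
    ultimately obtain v where "above u v" "above v (t0, Suc r, b)"
      using removable_below_good_addable[OF mp good] by blast
    then show False by (cases v) (auto simp: u above_iff)
  qed
  have sub: "lam t \<subseteq> add_box u lam t" by (auto simp: u add_box_def)
  have "(Suc a', b) \<in> add_box u lam t" if "1 \<le> b" "(a', Suc b) \<in> add_box u lam t" for a' b
  proof (cases "(a', Suc b) \<in> lam t")
    case True
    then show ?thesis using two_restrictedD[OF Y adm True \<open>1 \<le> b\<close>] sub by blast
  next
    case False
    then have "t = t0" "a' = r" "c = Suc b"
      using that by (auto simp: u add_box_def split: if_splits)
    then show ?thesis using key[of b] that sub by blast
  qed
  then show ?thesis unfolding two_restricted_iff[OF Y'] by blast
qed

text \<open>
  Here the box one up and one to the right is the removable box that would directly precede \<open>u\<close>.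
\<close>

lemma two_restricted_remove_good:
  assumes mp: "multipartition lam" and adm: "two_restricted (lam t)"
    and good: "good_removable \<kappa> i lam u"
  shows "two_restricted (remove_box u lam t)"
proof -
  obtain t0 r c where u: "u = (t0, r, c)" by (cases u)
  have Y: "young_diagram (lam s)" for s using multipartition_young[OF mp] .
  have a: "removable \<kappa> i lam (t0, r, c)" using good_removableD[OF mp good] u by simp
  have Y': "young_diagram (remove_box u lam t)"
    using multipartition_young a unfolding u removable_def by blast
  have key: "(r', Suc c) \<notin> lam t0" if "r = Suc r'" "t = t0" for r'
  proof
    assume n: "(r', Suc c) \<in> lam t0"
    have rc: "(r, Suc c) \<notin> lam t0" "\<kappa> t0 + of_nat c - of_nat r = i" "1 \<le> c"
      using a young_diagram_boxD[OF Y, of r c t0] unfolding removable_iff[OF mp] by auto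
    have "\<kappa> t0 + of_nat (Suc c) - of_nat r' = \<kappa> t0 + of_nat c - of_nat (Suc r')"
      unfolding residue_eq_iff by auto
    moreover have "(r', Suc (Suc c)) \<notin> lam t0"
      using two_restrictedD[OF Y, of t0 r' "Suc c"] adm rc that by auto
    ultimately have "removable \<kappa> i lam (t0, r', Suc c)"
      unfolding removable_iff[OF mp] using n rc that by auto
    moreover have "above (t0, r', Suc c) u" using that by (simp add: above_iff u)
    ultimately obtain v where "above (t0, r', Suc c) v" "above v u"
      using addable_above_good_removable[OF mp good] by blast
    then show False using that by (cases v) (auto simp: u above_iff)
  qed
  have "(Suc a', b) \<in> remove_box u lam t" if b: "1 \<le> b" "(a', Suc b) \<in> remove_box u lam t" for a' b
  proof -
    have ab: "(a', Suc b) \<in> lam t" using b(2) by (auto simp: u remove_box_def split: if_splits)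
    then have "(Suc a', b) \<in> lam t" using two_restrictedD[OF Y adm] b(1) by blast
    moreover have "\<not> (t = t0 \<and> Suc a' = r \<and> b = c)" using key[of a'] ab by auto
    ultimately show ?thesis by (auto simp: u remove_box_def)
  qed
  then show ?thesis unfolding two_restricted_iff[OF Y'] by blast
qed

text \<open>
  The third condition becomes effective for \<open>u\<close> when component \<open>u\<close> receives its first box. If all gaps
  were small, then going down from \<open>u\<close> the parity of the next addable box would force every component
  strictly between \<open>s\<close> and \<open>u\<close>, and then \<open>s\<close> itself, to be empty; but then the first box of component
  \<open>s\<close> is addable with the same residue and lies below with nothing removable in between.
\<close>

lemma good_addable_into_empty:
  assumes mp: "multipartition lam" and good: "good_addable \<kappa> i lam (u, Suc 0, Suc 0)"
    and s: "1 \<le> s" "s + 2 \<le> u" and empty: "lam u = {}"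
    and charge: "\<kappa> s \<noteq> \<kappa> (Suc s)" "\<And>j. Suc s \<le> j \<Longrightarrow> j \<le> u - 1 \<Longrightarrow> \<kappa> j = \<kappa> (Suc s)"
      "\<kappa> (u - 1) \<noteq> \<kappa> u"
  shows "\<exists>t \<in> {s..u - 1}. 1 \<le> gap \<kappa> (add_box (u, Suc 0, Suc 0) lam) t"
proof (rule ccontr)
  let ?mu = "add_box (u, Suc 0, Suc 0) lam"
  assume neg: "\<not> ?thesis"
  have Y: "young_diagram (lam s)" for s using multipartition_young[OF mp] .
  have a: "addable \<kappa> i lam (u, Suc 0, Suc 0)" using good_addableD[OF mp good] .
  have i: "\<kappa> u = i" using addable_empty(3)[OF mp a empty] .
  have gap_le: "gap \<kappa> lam t \<le> of_bool (Suc t = u)" if "s \<le> t" "t \<le> u - 1" for t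
  proof -
    have "gap \<kappa> ?mu t = gap \<kappa> lam t - of_bool (Suc t = u)"
      using gap_add_box[OF mp a, of \<kappa> t] that s by auto
    then show ?thesis using neg that by force
  qed
  \<comment> \<open>The parity states that the box addable to the first row of \<open>v\<close> has the residue of the new box.\<close>
  have not_i: "\<not> (\<kappa> v = \<kappa> u \<longleftrightarrow> even (width (lam v)))"
    if v: "1 \<le> v" "v < u" and empty_above: "\<And>j. v < j \<Longrightarrow> j \<le> u \<Longrightarrow> lam j = {}" for v
  proof
    assume eq: "\<kappa> v = \<kappa> u \<longleftrightarrow> even (width (lam v))"
    then have "\<kappa> v + of_nat (Suc (width (lam v))) - of_nat (Suc 0) = \<kappa> u + of_nat (Suc 0) - of_nat (Suc 0)"
      unfolding residue_eq_iff by auto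
    then have "addable \<kappa> i lam (v, Suc 0, Suc (width (lam v)))"
      unfolding addable_row_1[OF mp v(1)] using i by auto
    moreover have "above (u, Suc 0, Suc 0) (v, Suc 0, Suc (width (lam v)))"
      using v by (simp add: above_iff)
    ultimately obtain w where w: "removable \<kappa> i lam w" "above (u, Suc 0, Suc 0) w"
        "above w (v, Suc 0, Suc (width (lam v)))"
      using removable_below_good_addable[OF mp good] by blast
    obtain t' r' c' where weq: "w = (t', r', c')" by (cases w)
    have mem: "(r', c') \<in> lam t'" using w(1) unfolding weq removable_iff[OF mp] by blast
    then have "v < t'" "t' \<le> u"
      using w(2,3) young_diagram_boxD[OF Y mem] by (auto simp: weq above_iff)
    then show False using empty_above mem by blast
  qed
  have middle: "\<kappa> v = \<kappa> (Suc s)" "\<kappa> v \<noteq> \<kappa> u" if "Suc s \<le> v" "v < u" for v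
    using charge(2)[of v] charge(2)[of "u - 1"] charge(3) that s by auto
  have empty_between: "lam v = {}" if "Suc s \<le> v" "v \<le> u" for v
    using that
  proof (induction "u - v" arbitrary: v rule: less_induct)
    case less
    show ?case
    proof (cases "v = u")
      case False
      then have v: "v < u" "1 \<le> v" using less.prems by auto
      have above_v: "lam j = {}" if "v < j" "j \<le> u" for j
        using less.hyps[of j] that less.prems by auto
      have "even (width (lam v))" using not_i[OF v(2,1) above_v] middle(2) less.prems v by blast
      moreover have "width (lam v) \<le> 1"
      proof (cases "Suc v = u")
        case True
        then show ?thesis
          using gap_le[of v] middle(2)[of v] less.prems v above_v[of "Suc v"] by (simp add: gap_def)
      next
        case False
        then have "\<kappa> v = \<kappa> (Suc v)"
          using middle(1)[of v] middle(1)[of "Suc v"] less.prems v by simp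
        then show ?thesis
          using gap_le[of v] False less.prems v above_v[of "Suc v"] by (simp add: gap_def)
      qed
      ultimately have "width (lam v) = 0" by (cases "width (lam v)") auto
      then show ?thesis using width_eq_0_iff[OF Y] by blast
    qed (simp add: empty)
  qed
  have "\<kappa> s = \<kappa> u"
    using bit_eq_if_both_differ charge(1) middle[of "Suc s"] s by auto
  then have "odd (width (lam s))" using not_i[of s] s empty_between by auto
  moreover have "int (width (lam s)) \<le> 0"
    using gap_le[of s] s empty_between[of "Suc s"] charge(1) by (simp add: gap_def)
  ultimately show False by auto
qed

text \<open>
  The case left open by \<open>good_removable_not_at_odd_gap\<close>. The second condition propagates emptiness
  upwards from component \<open>t + 1\<close> to \<open>u - 1\<close> and forces the first column of component \<open>u\<close> to have length
  one. Its box is removable of the same residue as the given one, and the empty components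
  in between offer only addable boxes of the other residue.
\<close>

lemma good_removable_over_empty:
  assumes mp: "multipartition lam" and adm: "admissible \<kappa> lam"
    and good: "good_removable \<kappa> i lam (t, Suc 0, c)" and gap: "gap \<kappa> lam t = 1"
    and t: "1 \<le> t" "Suc t < u" and empty: "lam (Suc t) = {}" and ne: "lam u \<noteq> {}"
    and charge: "\<And>j. Suc t \<le> j \<Longrightarrow> j < u \<Longrightarrow> \<kappa> j \<noteq> \<kappa> u"
  shows False
proof -
  have Y: "young_diagram (lam s)" for s using multipartition_young[OF mp] .
  note a = good_removableD[OF mp good, unfolded removable_iff[OF mp]]
  have c: "c = width (lam t)" using a unfolding mem_row_1[OF Y] by auto
  have empty_between: "lam v = {}" if "Suc t \<le> v" "v < u" for v
    using that
  proof (induction v rule: dec_induct)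
    case (step n)
    have "\<kappa> n = \<kappa> (Suc n)"
      using bit_eq_if_both_differ charge[of n] charge[of "Suc n"] step by (metis Suc_lessD le_SucI)
    then have "height (lam (Suc n)) = 0"
      using admissible_gap[OF adm, of n] step t by (simp add: gap_def)
    then show ?case using height_eq_0_iff[OF Y] by blast
  qed (simp add: empty)
  have h: "height (lam u) = 1"
  proof -
    obtain v where v: "u = Suc v" using t by (cases u) auto
    then have "height (lam u) \<le> 1"
      using admissible_gap[OF adm, of v] empty_between[of v] charge[of v] t by (simp add: gap_def)
    then show ?thesis using height_eq_0_iff[OF Y, of u] ne by linarith
  qed
  have "\<kappa> t + of_nat c - of_nat (Suc 0) = \<kappa> u + of_nat (Suc 0) - of_nat (Suc 0)"
  proof -
    have "\<kappa> (Suc t) \<noteq> \<kappa> u" using charge t by auto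
    then have "\<kappa> t = \<kappa> u \<longleftrightarrow> \<kappa> t \<noteq> \<kappa> (Suc t)" using bit_eq_if_both_differ by metis
    moreover have "int c = 1 + of_bool (\<kappa> t = \<kappa> (Suc t))" using gap c empty by (simp add: gap_def)
    ultimately show ?thesis unfolding residue_eq_iff by (cases "\<kappa> t = \<kappa> (Suc t)") auto
  qed
  then have i: "\<kappa> u + of_nat (Suc 0) - of_nat (Suc 0) = i" using a by metis
  then have "removable \<kappa> i lam (u, Suc 0, Suc 0)"
    using removable_col_1[OF mp admissible_two_restricted[OF adm] ne] h by (metis One_nat_def)
  moreover have "above (u, Suc 0, Suc 0) (t, Suc 0, c)" using t by (simp add: above_iff)
  ultimately obtain w
    where w: "addable \<kappa> i lam w" "above (u, Suc 0, Suc 0) w" "above w (t, Suc 0, c)"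
    using addable_above_good_removable[OF mp good] by blast
  obtain t' r' c' where weq: "w = (t', r', c')" by (cases w)
  have w1: "1 \<le> r'" "\<kappa> t' + of_nat c' - of_nat r' = i"
    using w(1) unfolding weq addable_iff[OF mp] by blast+
  then consider "t' = u" "Suc 0 < r'" | "t < t'" "t' < u"
    using w(2,3) by (auto simp: weq above_iff)
  then show False
  proof cases
    case 1
    then have "r' = Suc (Suc 0)" "c' = Suc 0"
      using addable_below_height[OF mp, of \<kappa> i t' r' c'] w(1) weq h by auto
    then have "\<kappa> u + of_nat (Suc 0) - of_nat (Suc (Suc 0)) = \<kappa> u + of_nat (Suc 0) - of_nat (Suc 0)"
      using w1(2) i 1 by metis
    then show False unfolding residue_eq_iff by auto
  next
    case 2
    then have "\<kappa> t' = i"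
      using addable_empty(3)[OF mp] w(1) weq empty_between[of t'] by auto
    moreover have "\<kappa> u = i" using i by (metis add_diff_cancel_right')
    ultimately show False using charge[of t'] 2 by auto
  qed
qed

text \<open>
  The gaps change by at most one, so the bounds \<open>-1\<close> and \<open>1\<close> can only be lost from an odd value.
\<close>

lemma admissible_add_good:
  assumes mp: "multipartition lam" and adm: "admissible \<kappa> lam" and good: "good_addable \<kappa> i lam b"
  shows "admissible \<kappa> (add_box b lam)"
proof -
  let ?mu = "add_box b lam"
  obtain t0 r c where b: "b = (t0, r, c)" by (cases b)
  have a: "addable \<kappa> i lam (t0, r, c)" using good_addableD[OF mp good] b by simp
  note gap_mu = gap_add_box[OF mp a, folded b]
  have even_gap: "even (gap \<kappa> lam t)" if "1 \<le> t" "Suc t = t0" "c = 1" for t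
    using good_addable_not_at_odd_gap[OF mp, of \<kappa> i t r] good that b by simp
  show ?thesis
    unfolding admissible_def
  proof (intro conjI allI impI; (elim conjE)?)
    show "two_restricted (?mu t)" for t
      using two_restricted_add_good[OF mp admissible_two_restricted[OF adm] good] .
    show "-1 \<le> gap \<kappa> ?mu t" if t: "1 \<le> t" for t
    proof (rule ccontr)
      assume "\<not> ?thesis"
      then have "Suc t = t0 \<and> c = 1 \<and> gap \<kappa> lam t = -1"
        using gap_mu[of \<kappa> t] admissible_gap[OF adm t] by (auto simp: of_bool_def split: if_splits)
      then show False using even_gap[OF t] by auto
    qed
    fix s u
    assume s: "1 \<le> s" "s + 2 \<le> u" and ne: "?mu u \<noteq> {}" and charge: "\<kappa> s \<noteq> \<kappa> (Suc s)"
      "\<forall>j \<in> {Suc s..u - 1}. \<kappa> j = \<kappa> (Suc s)" "\<kappa> (u - 1) \<noteq> \<kappa> u"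
    have const: "\<kappa> j = \<kappa> (Suc s)" if "Suc s \<le> j" "j \<le> u - 1" for j
      by (rule bspec[OF charge(2)]) (use that in simp)
    show "\<exists>t \<in> {s..u - 1}. 1 \<le> gap \<kappa> ?mu t"
    proof (cases "lam u = {}")
      case True
      then have "t0 = u" using ne by (auto simp: b add_box_def split: if_splits)
      then have eq: "b = (u, Suc 0, Suc 0)" using addable_empty(1,2)[OF mp a] True b by simp
      show ?thesis
        using good_addable_into_empty[OF mp good[unfolded eq] s True charge(1) const charge(3)]
        unfolding eq .
    next
      case False
      obtain t where t: "s \<le> t" "t \<le> u - 1" "1 \<le> gap \<kappa> lam t"
        using admissible_charge_return[OF adm s False charge(1) const charge(3)] by blast
      have "1 \<le> gap \<kappa> ?mu t"
      proof (rule ccontr)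
        assume "\<not> ?thesis"
        then have "Suc t = t0 \<and> c = 1 \<and> gap \<kappa> lam t = 1"
          using gap_mu[of \<kappa> t] t(3) by (auto simp: of_bool_def split: if_splits)
        then show False using even_gap[of t] t s by auto
      qed
      then show ?thesis using t by auto
    qed
  qed
qed

lemma admissible_remove_good:
  assumes mp: "multipartition lam" and adm: "admissible \<kappa> lam" and good: "good_removable \<kappa> i lam b"
  shows "admissible \<kappa> (remove_box b lam)"
proof -
  let ?mu = "remove_box b lam"
  obtain t0 r c where b: "b = (t0, r, c)" by (cases b)
  have rem: "removable \<kappa> i lam b" using good_removableD[OF mp good] .
  have mp': "multipartition ?mu" using rem by (simp add: removable_def)
  have a: "addable \<kappa> i ?mu (t0, r, c)" using signature_remove_box(2)[OF mp rem] b by blast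
  have "add_box (t0, r, c) ?mu = lam"
    using f_op_remove_good[OF mp good]
      f_op_eq[OF mp' good_removable_imp_good_addable[OF mp good]] b by simp
  note gap_mu = gap_add_box[OF mp' a, unfolded this]
  have Y: "young_diagram (lam s)" for s using multipartition_young[OF mp] .
  have even_gap: "even (gap \<kappa> lam t)" if "t = t0" "r = 1" "lam (Suc t) \<noteq> {}" for t
    using good_removable_not_at_odd_gap[OF mp, of \<kappa> i t c] good that b
      admissible_two_restricted[OF adm] by simp
  show ?thesis
    unfolding admissible_def
  proof (intro conjI allI impI; (elim conjE)?)
    show "two_restricted (?mu t)" for t
      using two_restricted_remove_good[OF mp admissible_two_restricted[OF adm] good] .
    show "-1 \<le> gap \<kappa> ?mu t" if t: "1 \<le> t" for t
    proof (rule ccontr)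
      assume "\<not> ?thesis"
      then have low: "t = t0 \<and> r = 1 \<and> gap \<kappa> lam t = -1"
        using gap_mu[of \<kappa> t] admissible_gap[OF adm t] by (auto simp: of_bool_def split: if_splits)
      then have "lam (Suc t) = {}" using even_gap[of t] by (cases "lam (Suc t) = {}") auto
      then have "width (lam t) = 0" using low by (auto simp: gap_def of_bool_def split: if_splits)
      moreover have "(r, c) \<in> lam t" using rem low unfolding b removable_iff[OF mp] by blast
      ultimately show False using width_eq_0_iff[OF Y, of t] by auto
    qed
    fix s u
    assume s: "1 \<le> s" "s + 2 \<le> u" and ne: "?mu u \<noteq> {}" and charge: "\<kappa> s \<noteq> \<kappa> (Suc s)"
      "\<forall>j \<in> {Suc s..u - 1}. \<kappa> j = \<kappa> (Suc s)" "\<kappa> (u - 1) \<noteq> \<kappa> u"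
    have const: "\<kappa> j = \<kappa> (Suc s)" if "Suc s \<le> j" "j \<le> u - 1" for j
      by (rule bspec[OF charge(2)]) (use that in simp)
    have ne': "lam u \<noteq> {}" using ne by (auto simp: b remove_box_def split: if_splits)
    obtain t where t: "s \<le> t" "t \<le> u - 1" "1 \<le> gap \<kappa> lam t"
      using admissible_charge_return[OF adm s ne' charge(1) const charge(3)] by blast
    have "1 \<le> gap \<kappa> ?mu t"
    proof (rule ccontr)
      assume "\<not> ?thesis"
      then have low: "t = t0" "r = 1" "gap \<kappa> lam t = 1"
        using gap_mu[of \<kappa> t] t(3) by (auto simp: of_bool_def split: if_splits)
      then have empty: "lam (Suc t) = {}"
        using even_gap[of t] by (cases "lam (Suc t) = {}") auto
      then have "Suc t \<noteq> u" using ne' by auto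
      then have "Suc t < u" using t s by linarith
      moreover have "\<kappa> j \<noteq> \<kappa> u" if "Suc t \<le> j" "j < u" for j
        using const[of j] const[of "u - 1"] charge(3) that t s by auto
      moreover have "good_removable \<kappa> i lam (t, Suc 0, c)" using good low b by simp
      moreover have "1 \<le> t" using t s by simp
      ultimately show False
        using good_removable_over_empty[OF mp adm _ low(3) _ _ empty ne'] by blast
    qed
    then show "\<exists>t \<in> {s..u - 1}. 1 \<le> gap \<kappa> ?mu t" using t by auto
  qed
qed

text \<open>
  The bottom box of the first column of the lowest nonempty component \<open>u\<close> is unarced. An arc from it
  would end in an empty component whose charge is the residue of the box; by the second condition
  the first column of component \<open>u\<close> has length one, and the charge changes directly below \<open>u\<close>. For the
  highest \<open>s\<close> below \<open>u\<close> with the same charge as \<open>u\<close>, the third condition then asks for a component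
  below \<open>u\<close> with a positive gap, which an empty component does not have.
\<close>

lemma ex_good_removable_admissible:
  assumes mp: "multipartition lam" and adm: "admissible \<kappa> lam" and ne: "lam \<noteq> empty_multipartition"
  shows "\<exists>i u. good_removable \<kappa> i lam u"
proof -
  have Y: "young_diagram (lam s)" for s using multipartition_young[OF mp] .
  have "\<exists>t. lam t \<noteq> {}" using ne by (auto simp: empty_multipartition_def)
  then obtain u where u: "lam u \<noteq> {}" and least: "\<And>t. t < u \<Longrightarrow> lam t = {}"
    using exists_least_iff[of "\<lambda>t. lam t \<noteq> {}"] by blast
  have "u \<noteq> 0" using u multipartition_0[OF mp] by metis
  let ?h = "height (lam u)" and ?A = "\<lambda>i. arc_arrangement \<kappa> i lam"
  define i where "i = \<kappa> u + of_nat (Suc 0) - of_nat ?h"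
  let ?b = "(u, ?h, Suc 0)"
  have rem: "removable \<kappa> i lam ?b"
    using removable_col_1[OF mp admissible_two_restricted[OF adm] u] i_def by blast
  have "?b \<notin> Field (?A i)"
  proof
    assume "?b \<in> Field (?A i)"
    then obtain v where v: "(?b, v) \<in> ?A i"
      using partial_arcs_Field(1)[OF mp partial_arc_arrangement[OF mp]] rem by blast
    then have add: "addable \<kappa> i lam v" and ab: "above ?b v"
      using partial_arcsD[OF mp partial_arc_arrangement[OF mp]] by blast+
    obtain t' r' c' where veq: "v = (t', r', c')" by (cases v)
    have a: "1 \<le> t'" "\<kappa> t' + of_nat c' - of_nat r' = i"
      using add unfolding veq addable_iff[OF mp] by blast+
    have "\<not> (t' = u \<and> ?h < r')"
    proof
      assume "t' = u \<and> ?h < r'"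
      then have "t' = u" "r' = Suc ?h" "c' = Suc 0"
        using addable_below_height[OF mp, of \<kappa> i t' r' c'] add veq by auto
      then have "\<kappa> u + of_nat (Suc 0) - of_nat (Suc ?h) = \<kappa> u + of_nat (Suc 0) - of_nat ?h"
        using a(2) i_def by metis
      then have "even (Suc 0 + Suc ?h + Suc 0 + ?h)" unfolding residue_eq_iff by blast
      then show False by presburger
    qed
    then have t': "t' < u" using ab by (auto simp: veq above_iff)
    then have \<kappa>t': "\<kappa> t' = i" using addable_empty(3)[OF mp] add veq least by blast
    obtain p where p: "u = Suc p" "1 \<le> p" using t' a(1) by (cases u) auto
    have "1 \<le> ?h" using height_eq_0_iff[OF Y, of u] u by linarith
    then have h: "?h = 1" "\<kappa> p \<noteq> \<kappa> u"
      using admissible_gap[OF adm p(2)] least[of p] p by (auto simp: gap_def of_bool_def split: if_splits)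
    then have i: "i = \<kappa> u" by (simp add: i_def)
    \<comment> \<open>The charge differs from that of \<open>u\<close> on all components strictly between \<open>s\<close> and \<open>u\<close>.\<close>
    define s where "s = Max {t. t < u \<and> \<kappa> t = \<kappa> u}"
    have fin: "finite {t. t < u \<and> \<kappa> t = \<kappa> u}" by simp
    have "s \<in> {t. t < u \<and> \<kappa> t = \<kappa> u}"
      unfolding s_def using fin t' \<kappa>t' i by (intro Max_in) auto
    then have s: "s < u" "\<kappa> s = \<kappa> u" by auto
    have "t' \<le> s" unfolding s_def using fin t' \<kappa>t' i by (intro Max_ge) auto
    have after: "\<kappa> j \<noteq> \<kappa> u" if "s < j" "j < u" for j
    proof
      assume "\<kappa> j = \<kappa> u"
      then have "j \<le> s" unfolding s_def using fin that(2) by (intro Max_ge) auto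
      then show False using that(1) by simp
    qed
    have "s \<noteq> p" using s h by auto
    then have s2: "s + 2 \<le> u" using s p by auto
    have "\<kappa> j = \<kappa> (Suc s)" if "Suc s \<le> j" "j \<le> u - 1" for j
      using bit_eq_if_both_differ[of "\<kappa> j" "\<kappa> u" "\<kappa> (Suc s)"] after[of j] after[of "Suc s"] that s2
      by force
    moreover have "\<kappa> s \<noteq> \<kappa> (Suc s)" using s after[of "Suc s"] s2 by auto
    moreover have "1 \<le> s" using \<open>t' \<le> s\<close> a(1) by simp
    moreover have "\<kappa> (u - 1) \<noteq> \<kappa> u" using h p by simp
    ultimately obtain t where t: "s \<le> t" "t \<le> u - 1" "1 \<le> gap \<kappa> lam t"
      using admissible_charge_return[OF adm _ s2 u] by metis
    then have "lam t = {}" using least[of t] p by auto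
    then show False using t(3) by (simp add: gap_def of_bool_def split: if_splits)
  qed
  then show ?thesis using ex_good_removable[OF mp rem] by blast
qed

section \<open>The classification\<close>

lemma multipartition_empty: "multipartition empty_multipartition"
  by (simp add: multipartition_def empty_multipartition_def)

lemma admissible_empty: "admissible \<kappa> empty_multipartition"
  by (auto simp: admissible_def empty_multipartition_def gap_def two_restricted_def col_len_def)

lemma kleshchev_imp_admissible:
  assumes \<kappa>: "multicharge \<kappa>" and "kleshchev \<kappa> lam"
  shows "admissible \<kappa> lam"
proof -
  have "multipartition (fold (f_op \<kappa>) is empty_multipartition) \<and>
    admissible \<kappa> (fold (f_op \<kappa>) is empty_multipartition)" for "is"
  proof (induction "is" rule: rev_induct)
    case (snoc i "is")
    let ?mu = "fold (f_op \<kappa>) is empty_multipartition"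
    have mp: "multipartition ?mu" using snoc by blast
    obtain b where b: "good_addable \<kappa> i ?mu b" using ex_good_addable[OF mp \<kappa>] by blast
    then have "multipartition (add_box b ?mu)" using good_addableD[OF mp] by (auto simp: addable_def)
    then show ?case using f_op_eq[OF mp b] admissible_add_good[OF mp _ b] snoc by simp
  qed (simp add: multipartition_empty admissible_empty)
  then show ?thesis using assms(2) unfolding kleshchev_def by blast
qed

lemma admissible_imp_kleshchev:
  assumes "multipartition lam" "admissible \<kappa> lam"
  shows "kleshchev \<kappa> lam"
  using assms
proof (induction "card (boxes lam)" arbitrary: lam rule: less_induct)
  case less
  note mp = less.prems(1) and adm = less.prems(2)
  show ?case
  proof (cases "lam = empty_multipartition")
    case True
    then show ?thesis unfolding kleshchev_def by (intro exI[of _ "[]"]) simp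
  next
    case False
    obtain i b where b: "good_removable \<kappa> i lam b"
      using ex_good_removable_admissible[OF mp adm False] by blast
    let ?mu = "remove_box b lam"
    have rem: "removable \<kappa> i lam b" using good_removableD[OF mp b] .
    have "boxes ?mu = boxes lam - {b}"
      by (cases b) (auto simp: boxes_def remove_box_def split: if_splits)
    then have "boxes ?mu \<subset> boxes lam" using rem by (auto simp: removable_def)
    then have "card (boxes ?mu) < card (boxes lam)"
      by (rule psubset_card_mono[OF finite_boxes[OF mp]])
    moreover have "multipartition ?mu" using rem by (simp add: removable_def)
    ultimately have "kleshchev \<kappa> ?mu" using less.hyps admissible_remove_good[OF mp adm b] by blast
    then obtain "is" where "?mu = fold (f_op \<kappa>) is empty_multipartition"
      unfolding kleshchev_def by blast
    then have "lam = fold (f_op \<kappa>) (is @ [i]) empty_multipartition"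
      using f_op_remove_good[OF mp b] by simp
    then show ?thesis unfolding kleshchev_def by blast
  qed
qed

lemma gap_ge_beyond_level:
  assumes "has_level lam l" "l \<le> t"
  shows "-1 \<le> gap \<kappa> lam t"
  using assms by (simp add: has_level_def gap_def)

theorem theoremC:
  fixes \<kappa> :: multicharge and lam :: multidiagram and l :: nat
  assumes "multicharge \<kappa>" and "multipartition lam" and "has_level lam l"
  shows "kleshchev \<kappa> lam \<longleftrightarrow>
    (\<forall>t \<in> {1..l}. two_restricted (lam t)) \<and>
    (\<forall>t \<in> {1..l - 1}.
       int (row_len (lam t) 1) - int (row_len (conjugate (lam (t + 1))) 1)
         \<ge> of_bool (\<kappa> t = \<kappa> (t + 1)) - 1) \<and>
    (\<forall>s \<in> {1..l - 2}. \<forall>u \<in> {s + 2..l}.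
       lam u \<noteq> {} \<and> \<kappa> s \<noteq> \<kappa> (s + 1) \<and>
       (\<forall>j \<in> {s + 1..u - 1}. \<kappa> j = \<kappa> (s + 1)) \<and> \<kappa> (u - 1) \<noteq> \<kappa> u \<longrightarrow>
       (\<exists>t \<in> {s..u - 1}.
          int (row_len (lam t) 1) - int (row_len (conjugate (lam (t + 1))) 1)
            \<ge> of_bool (\<kappa> t = \<kappa> (t + 1)) + 1))"
    (is "_ \<longleftrightarrow> ?one \<and> ?two \<and> ?three")
proof -
  have lev: "lam t = {}" if "l < t" for t using assms(3) that by (simp add: has_level_def)
  have gap: "int (row_len (lam t) 1) - int (row_len (conjugate (lam (t + 1))) 1)
      \<ge> of_bool (\<kappa> t = \<kappa> (t + 1)) + k \<longleftrightarrow> k \<le> gap \<kappa> lam t" for t k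
    by (auto simp: gap_def width_def height_def)
  have "?one \<longleftrightarrow> (\<forall>t. two_restricted (lam t))"
  proof -
    have "two_restricted (lam t)" if "t \<notin> {1..l}" for t
    proof -
      have "lam t = {}" using that lev[of t] multipartition_0[OF assms(2)] by (cases t) auto
      then show ?thesis by (simp add: two_restricted_def col_len_def)
    qed
    then show ?thesis by blast
  qed
  moreover have "?two \<longleftrightarrow> (\<forall>t \<ge> 1. -1 \<le> gap \<kappa> lam t)"
  proof -
    have "?two \<longleftrightarrow> (\<forall>t \<in> {1..l - 1}. -1 \<le> gap \<kappa> lam t)"
      using gap[of _ "-1"] by simp
    moreover have "-1 \<le> gap \<kappa> lam t" if "1 \<le> t" "t \<notin> {1..l - 1}" for t
      using that gap_ge_beyond_level[OF assms(3), of t] by auto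
    moreover have "1 \<le> t" if "t \<in> {1..l - 1}" for t using that by simp
    ultimately show ?thesis by metis
  qed
  moreover have "?three \<longleftrightarrow> (\<forall>s u. 1 \<le> s \<and> s + 2 \<le> u \<and> lam u \<noteq> {} \<and> \<kappa> s \<noteq> \<kappa> (Suc s) \<and>
        (\<forall>j \<in> {Suc s..u - 1}. \<kappa> j = \<kappa> (Suc s)) \<and> \<kappa> (u - 1) \<noteq> \<kappa> u \<longrightarrow>
        (\<exists>t \<in> {s..u - 1}. 1 \<le> gap \<kappa> lam t))"
  proof -
    have "u \<le> l" if "lam u \<noteq> {}" for u using lev that by (meson not_le)
    then have range: "s \<in> {1..l - 2} \<and> u \<in> {s + 2..l} \<and> lam u \<noteq> {} \<longleftrightarrow>
        1 \<le> s \<and> s + 2 \<le> u \<and> lam u \<noteq> {}" for s u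
      by fastforce
    then have "(\<forall>s \<in> {1..l - 2}. \<forall>u \<in> {s + 2..l}. lam u \<noteq> {} \<and> Q s u \<longrightarrow> R s u) \<longleftrightarrow>
        (\<forall>s u. 1 \<le> s \<and> s + 2 \<le> u \<and> lam u \<noteq> {} \<and> Q s u \<longrightarrow> R s u)" for Q R :: "nat \<Rightarrow> nat \<Rightarrow> bool"
      by metis
    then show ?thesis unfolding Suc_eq_plus1[symmetric] gap[of _ 1, unfolded Suc_eq_plus1[symmetric]] .
  qed
  ultimately have "?one \<and> ?two \<and> ?three \<longleftrightarrow> admissible \<kappa> lam"
    unfolding admissible_def by blast
  then show ?thesis
    using kleshchev_imp_admissible[OF assms(1)] admissible_imp_kleshchev[OF assms(2)] by blast
qed

end
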